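(* Let $\mathcal M$ be a model of $T_{FPL}$ which is infinite. Then the set $\mu(\mathcal M)$ of metrically modular elements of $\mathcal M$ is a Boolean sublattice of $\mathcal M$.
   Context: We use continuous first-order logic of metric structures. The language $\mathfrak L$ has one sort (a complete metric space of diameter $1$), constants $0,1$, and a binary function symbol $+$ that is contractive for the $\ell^1$-metric on pairs. For $n\ge2$, $P_n$ is the lattice of partitions of $\{1,\dots,n\}$ ordered by refinement ($x\le y$ iff every block of $x$ is contained in a block of $y$), with join $+$, minimal element $0$, maximal element $1$, and metric $d(x,y)=\frac{\#x+\#y-2\#(x+y)}{n-1}$, where $\#x$ is the number of blocks. $T_{FPL}$ is the set of all $\mathfrak L$-sentences $\sigma$ with $\sigma^{P_n}=0$ for all $n\ge2$; $\mathcal M\models T_{FPL}$ means $\sigma^{\mathcal M}=0$ for all $\sigma\in T_{FPL}$. Every model $\mathcal M$ of $T_{FPL}$ is a complete lattice under the order $x\le y\iff x+y=y$, with join $+$; its meet (greatest lower bound) is written $xy$. Put $|x|=d(x,0)$. An element $x\in\mathcal M$ is metrically modular if $|x+y|+|xy|=|x|+|y|$ for all $y\in\mathcal M$. A Boolean sublattice is a subset containing $0,1$, closed under join and meet, that is distributive and complemented as a lattice. *)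

theory Defs
  imports "HOL-Analysis.Function_Topology" "HOL-Analysis.Abstract_Metric_Spaces"
    "HOL-Algebra.Lattice" "HOL-Library.Disjoint_Sets"
begin

section \<open>Structures\<close>

record 'a lstruct = "'a partial_object" +
  ldist :: "'a \<Rightarrow> 'a \<Rightarrow> real"
  lzero :: 'a
  lone :: 'a
  ladd :: "'a \<Rightarrow> 'a \<Rightarrow> 'a"

text \<open>The locale \<^locale>\<open>Metric_space\<close> asks for nonnegativity and symmetry on the whole type.
  Setting the distance to \<open>0\<close> outside the carrier avoids imposing anything there.\<close>

definition ldist_on :: "'a lstruct \<Rightarrow> 'a \<Rightarrow> 'a \<Rightarrow> real" where
  "ldist_on M x y = (if x \<in> carrier M \<and> y \<in> carrier M then ldist M x y else 0)"

text \<open>As usual in continuous logic, ``diameter 1'' is the diameter bound attached to the sort.  For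
  models of the theory below the diameter is exactly \<open>1\<close>, because \<open>1 - d(0,1)\<close> is a sentence that
  vanishes in every partition lattice.\<close>

definition is_lstruct :: "'a lstruct \<Rightarrow> bool" where
  "is_lstruct M \<longleftrightarrow>
     Metric_space (carrier M) (ldist_on M) \<and>
     Metric_space.mcomplete (carrier M) (ldist_on M) \<and>
     (\<forall>x\<in>carrier M. \<forall>y\<in>carrier M. ldist M x y \<le> 1) \<and>
     lzero M \<in> carrier M \<and> lone M \<in> carrier M \<and>
     (\<forall>x\<in>carrier M. \<forall>y\<in>carrier M. ladd M x y \<in> carrier M) \<and>
     (\<forall>x\<in>carrier M. \<forall>y\<in>carrier M. \<forall>x'\<in>carrier M. \<forall>y'\<in>carrier M.
        ldist M (ladd M x y) (ladd M x' y') \<le> ldist M x x' + ldist M y y')"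


section \<open>Continuous first-order logic\<close>

datatype tm = Var nat | Zero | One | Add tm tm

text \<open>A \<open>k\<close>-ary connective is a continuous map from \<open>[0,1]\<^sup>k\<close> to \<open>[0,1]\<close>.  The cube is rendered as
  \<open>{..<k} \<rightarrow>\<^sub>E {0..1}\<close> with the product topology on functions; the values outside
  \<open>{..<k}\<close> are the constant \<^const>\<open>undefined\<close>, so this is the usual topology.\<close>

datatype fm =
    Dist tm tm
  | Conn "(nat \<Rightarrow> real) \<Rightarrow> real" "fm list"
  | SupQ nat fm
  | InfQ nat fm

definition connective :: "nat \<Rightarrow> ((nat \<Rightarrow> real) \<Rightarrow> real) \<Rightarrow> bool" where
  "connective k u \<longleftrightarrow>
     continuous_on ({..<k} \<rightarrow>\<^sub>E {0..1}) u \<and> u \<in> ({..<k} \<rightarrow>\<^sub>E {0..1}) \<rightarrow> {0..1}"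

definition tuple :: "real list \<Rightarrow> nat \<Rightarrow> real" where
  "tuple rs = (\<lambda>i\<in>{..<length rs}. rs ! i)"

fun is_formula :: "fm \<Rightarrow> bool" where
  "is_formula (Dist s t) \<longleftrightarrow> True"
| "is_formula (Conn u \<phi>s) \<longleftrightarrow> connective (length \<phi>s) u \<and> (\<forall>\<phi>\<in>set \<phi>s. is_formula \<phi>)"
| "is_formula (SupQ i \<phi>) \<longleftrightarrow> is_formula \<phi>"
| "is_formula (InfQ i \<phi>) \<longleftrightarrow> is_formula \<phi>"

fun fv_tm :: "tm \<Rightarrow> nat set" where
  "fv_tm (Var i) = {i}"
| "fv_tm Zero = {}"
| "fv_tm One = {}"
| "fv_tm (Add s t) = fv_tm s \<union> fv_tm t"

fun fv :: "fm \<Rightarrow> nat set" where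
  "fv (Dist s t) = fv_tm s \<union> fv_tm t"
| "fv (Conn u \<phi>s) = (\<Union>\<phi>\<in>set \<phi>s. fv \<phi>)"
| "fv (SupQ i \<phi>) = fv \<phi> - {i}"
| "fv (InfQ i \<phi>) = fv \<phi> - {i}"

definition sentence :: "fm \<Rightarrow> bool" where
  "sentence \<sigma> \<longleftrightarrow> is_formula \<sigma> \<and> fv \<sigma> = {}"

fun eval_tm :: "'a lstruct \<Rightarrow> tm \<Rightarrow> (nat \<Rightarrow> 'a) \<Rightarrow> 'a" where
  "eval_tm M (Var i) e = e i"
| "eval_tm M Zero e = lzero M"
| "eval_tm M One e = lone M"
| "eval_tm M (Add s t) e = ladd M (eval_tm M s e) (eval_tm M t e)"

fun eval :: "'a lstruct \<Rightarrow> fm \<Rightarrow> (nat \<Rightarrow> 'a) \<Rightarrow> real" where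
  "eval M (Dist s t) e = ldist M (eval_tm M s e) (eval_tm M t e)"
| "eval M (Conn u \<phi>s) e = u (tuple (map (\<lambda>\<phi>. eval M \<phi> e) \<phi>s))"
| "eval M (SupQ i \<phi>) e = (SUP a\<in>carrier M. eval M \<phi> (e(i := a)))"
| "eval M (InfQ i \<phi>) e = (INF a\<in>carrier M. eval M \<phi> (e(i := a)))"

text \<open>The value of a sentence does not depend on the assignment; a constant one is used.\<close>

definition sval :: "'a lstruct \<Rightarrow> fm \<Rightarrow> real" where
  "sval M \<sigma> = eval M \<sigma> (\<lambda>_. lzero M)"


section \<open>Finite partition lattices and their theory\<close>

definition partition_order :: "nat \<Rightarrow> nat set set gorder" where
  "partition_order n =
     \<lparr>carrier = {x. partition_on {1..n} x}, eq = (=), le = refines {1..n}\<rparr>"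

definition partition_lattice :: "nat \<Rightarrow> nat set set lstruct" where
  "partition_lattice n =
     \<lparr>carrier = carrier (partition_order n),
      ldist = (\<lambda>x y. (real (card x) + real (card y)
                      - 2 * real (card (x \<squnion>\<^bsub>partition_order n\<^esub> y))) / (real n - 1)),
      lzero = \<bottom>\<^bsub>partition_order n\<^esub>,
      lone = \<top>\<^bsub>partition_order n\<^esub>,
      ladd = (\<lambda>x y. x \<squnion>\<^bsub>partition_order n\<^esub> y)\<rparr>"

definition T_FPL :: "fm set" where
  "T_FPL = {\<sigma>. sentence \<sigma> \<and> (\<forall>n\<ge>2. sval (partition_lattice n) \<sigma> = 0)}"

definition models :: "'a lstruct \<Rightarrow> fm set \<Rightarrow> bool" (infix \<open>\<Turnstile>\<close> 50) where
  "M \<Turnstile> T \<longleftrightarrow> is_lstruct M \<and> (\<forall>\<sigma>\<in>T. sval M \<sigma> = 0)"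


section \<open>Lattice notions in a model\<close>

definition lorder :: "'a lstruct \<Rightarrow> 'a gorder" where
  "lorder M = \<lparr>carrier = carrier M, eq = (=), le = (\<lambda>x y. ladd M x y = y)\<rparr>"

definition lmeet :: "'a lstruct \<Rightarrow> 'a \<Rightarrow> 'a \<Rightarrow> 'a" where
  "lmeet M x y = x \<sqinter>\<^bsub>lorder M\<^esub> y"

definition lnorm :: "'a lstruct \<Rightarrow> 'a \<Rightarrow> real" where
  "lnorm M x = ldist M x (lzero M)"

definition metrically_modular :: "'a lstruct \<Rightarrow> 'a \<Rightarrow> bool" where
  "metrically_modular M x \<longleftrightarrow> x \<in> carrier M \<and>
     (\<forall>y\<in>carrier M. lnorm M (ladd M x y) + lnorm M (lmeet M x y) = lnorm M x + lnorm M y)"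

definition metrically_modular_elements :: "'a lstruct \<Rightarrow> 'a set" (\<open>\<mu>\<close>) where
  "\<mu> M = {x. metrically_modular M x}"

definition boolean_sublattice :: "'a lstruct \<Rightarrow> 'a set \<Rightarrow> bool" where
  "boolean_sublattice M B \<longleftrightarrow>
     B \<subseteq> carrier M \<and> lzero M \<in> B \<and> lone M \<in> B \<and>
     (\<forall>x\<in>B. \<forall>y\<in>B. ladd M x y \<in> B \<and> lmeet M x y \<in> B) \<and>
     (\<forall>x\<in>B. \<forall>y\<in>B. \<forall>z\<in>B.
        lmeet M x (ladd M y z) = ladd M (lmeet M x y) (lmeet M x z)) \<and>
     (\<forall>x\<in>B. \<exists>y\<in>B. ladd M x y = lone M \<and> lmeet M x y = lzero M)"

end

theory Submission
  imports Defs
begin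

text \<open>
  In the lattice of partitions of \<open>{1..n}\<close> the modular elements are the partitions with at most one
  block that is not a singleton.  Such a partition is a subset \<open>A\<close> of \<open>{1..n}\<close> collapsed to a point, and
  up to an error of order \<open>1 / n\<close> joins and meets of these partitions are unions and intersections
  of the corresponding subsets.  In an infinite model the error disappears, and what remains is a Boolean
  algebra.

  \<^bold>\<open>From the model to the finite lattices.\<close>  The meet is not a continuous operation, hence not
  available in formulas.  But in a model of the theory \<open>x\<close> is metrically modular if and only if for
  every \<open>y\<close> and every \<open>\<epsilon> > 0\<close> there is an element \<open>z\<close> that lies below \<open>x\<close> and below \<open>y\<close> up to \<open>\<epsilon>\<close>
  and has norm at least \<open>|x| + |y| - |x + y| - \<epsilon>\<close> (\<open>metrically_modular_iff_approx\<close>): semimodularity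
  makes any two such elements close to each other, so they form Cauchy sequences, whose
  limits are exact lower bounds.  Approximate modularity is expressed by a formula.

  \<^bold>\<open>Combinatorics.\<close>  If a partition \<open>x\<close> is approximately modular, it has few nontrivial blocks
  (\<open>few_nontrivial_blocks\<close>).  Hence \<open>x\<close> is close to the collapse of the union \<open>A\<close> of its nontrivial
  blocks.  The collapse \<open>c\<close> of the complement of \<open>A\<close> is then approximately a complement of \<open>x\<close>, and for
  every other approximately modular \<open>y\<close> one has \<open>|x + y| + |c + y| \<le> 1 + |y|\<close> up to a small error.
  This statement, \<open>complement_property\<close>, holds in all large partition lattices.  It transfers to every
  infinite model, because there are only finitely many small partition lattices, all of them finite,
  and they are told apart from an infinite model by a formula about many pairwise distinct
  elements (\<open>theory_transfer_large\<close>).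

  \<^bold>\<open>Boolean algebra.\<close>  In the model the approximate complements of a metrically modular \<open>x\<close> again form a
  Cauchy sequence, and the limit is a modular complement \<open>c\<close> with \<open>|y| = |xy| + |cy|\<close> for every
  modular \<open>y\<close> (\<open>complement_exists\<close>).  From this decomposition everything else is formal: meets
  of modular elements are modular in any semimodular lattice with a norm, \<open>x + y\<close> is the complement
  of the meet of the complements of \<open>x\<close> and \<open>y\<close>, and distributivity follows by comparing norms.
\<close>

section \<open>Partitions of a finite set\<close>

definition related :: "'a set set \<Rightarrow> 'a \<Rightarrow> 'a \<Rightarrow> bool" where
  "related P u v \<longleftrightarrow> (\<exists>X\<in>P. u \<in> X \<and> v \<in> X)"

definition kernel_partition :: "('a \<Rightarrow> 'b) \<Rightarrow> 'a set \<Rightarrow> 'a set set" where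
  "kernel_partition f V = (\<lambda>v. {u\<in>V. f u = f v}) ` V"

lemma related_refl: "partition_on V P \<Longrightarrow> v \<in> V \<Longrightarrow> related P v v"
  by (auto simp: related_def partition_on_def)

lemma related_sym: "related P u v \<Longrightarrow> related P v u"
  by (auto simp: related_def)

lemma related_same_block:
  assumes "partition_on V P" "X \<in> P" "u \<in> X" "related P u v"
  shows "v \<in> X"
proof -
  obtain Y where Y: "Y \<in> P" "u \<in> Y" "v \<in> Y" using assms(4) by (auto simp: related_def)
  then have "X = Y"
    using assms(1-3) disjointD[OF partition_onD2[OF assms(1)], of X Y] by auto
  then show ?thesis using Y by simp
qed

lemma related_trans:
  assumes "partition_on V P" "related P u v" "related P v w"
  shows "related P u w"
proof -
  obtain X where "X \<in> P" "u \<in> X" "v \<in> X" using assms(2) by (auto simp: related_def)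
  moreover from this have "w \<in> X" using related_same_block[OF assms(1) _ _ assms(3)] by simp
  ultimately show ?thesis by (auto simp: related_def)
qed

lemma related_in: "partition_on V P \<Longrightarrow> related P u v \<Longrightarrow> u \<in> V \<and> v \<in> V"
  by (auto simp: related_def partition_on_def)

lemma refines_iff_related:
  assumes "partition_on V P" "partition_on V Q"
  shows "refines V P Q \<longleftrightarrow> (\<forall>u v. related P u v \<longrightarrow> related Q u v)"
proof
  assume "refines V P Q"
  then show "\<forall>u v. related P u v \<longrightarrow> related Q u v"
    unfolding refines_def related_def by (meson subsetD)
next
  assume rel: "\<forall>u v. related P u v \<longrightarrow> related Q u v"
  have "\<exists>Y\<in>Q. X \<subseteq> Y" if X: "X \<in> P" for X
  proof -
    obtain u where u: "u \<in> X"
      using X assms(1) unfolding partition_on_def by (metis ex_in_conv)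
    have "u \<in> V" using u X assms(1) unfolding partition_on_def by blast
    then obtain Y where Y: "Y \<in> Q" "u \<in> Y"
      using assms(2) unfolding partition_on_def by blast
    have "X \<subseteq> Y"
    proof
      fix v assume "v \<in> X"
      then have "related Q u v" using rel u X by (auto simp: related_def)
      then show "v \<in> Y" using related_same_block[OF assms(2) Y] by blast
    qed
    then show ?thesis using Y by blast
  qed
  then show "refines V P Q" using assms by (auto simp: refines_def)
qed

lemma refines_relatedD: "refines V P Q \<Longrightarrow> related P u v \<Longrightarrow> related Q u v"
  using refines_iff_related[of V P Q] by (auto simp: refines_def)

lemma refines_partition_on: "refines V P Q \<Longrightarrow> partition_on V P \<and> partition_on V Q"
  by (simp add: refines_def)

lemma partition_on_kernel: "partition_on V (kernel_partition f V)"
  by (auto simp: partition_on_def kernel_partition_def disjoint_def)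

lemma related_kernel [simp]:
  "related (kernel_partition f V) u v \<longleftrightarrow> u \<in> V \<and> v \<in> V \<and> f u = f v"
  by (auto simp: related_def kernel_partition_def)

lemma refines_kernelI:
  assumes "partition_on V P" "\<And>u v. related P u v \<Longrightarrow> f u = f v"
  shows "refines V P (kernel_partition f V)"
  using assms related_in[OF assms(1)] by (subst refines_iff_related) (auto simp: partition_on_kernel)

text \<open>All counts of blocks below are reduced to this lemma and the next one: a set of pairwise unrelated
  points bounds the number of blocks from below, a set that meets all blocks bounds it from above.\<close>
lemma card_le_card_blocks:
  assumes V: "finite V" "partition_on V P" and S: "S \<subseteq> V"
    and sep: "\<And>u v. u \<in> S \<Longrightarrow> v \<in> S \<Longrightarrow> related P u v \<Longrightarrow> u = v"
  shows "card S \<le> card P"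
proof -
  have "\<forall>v\<in>S. \<exists>X. X \<in> P \<and> v \<in> X"
    using V(2) S by (auto simp: partition_on_def)
  then obtain b where b: "\<forall>v\<in>S. b v \<in> P \<and> v \<in> b v" by metis
  have "inj_on b S"
    by (rule inj_onI) (metis b related_def sep)
  then show ?thesis
    using b finite_elements[OF V] by (intro card_inj_on_le[of b]) auto
qed

lemma card_blocks_le_card:
  assumes V: "finite S" "partition_on V P"
    and cov: "\<And>v. v \<in> V \<Longrightarrow> \<exists>s\<in>S. related P v s"
  shows "card P \<le> card S"
proof -
  have "\<exists>s. s \<in> S \<and> s \<in> X" if X: "X \<in> P" for X
  proof -
    obtain u where u: "u \<in> X"
      using X V(2) unfolding partition_on_def by (metis ex_in_conv)
    moreover have "u \<in> V" using u X V(2) unfolding partition_on_def by blast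
    ultimately show ?thesis using cov related_same_block[OF V(2) X] by metis
  qed
  then obtain s where s: "\<forall>X\<in>P. s X \<in> S \<and> s X \<in> X" by metis
  have "inj_on s P"
  proof (rule inj_onI)
    fix X Y assume "X \<in> P" "Y \<in> P" "s X = s Y"
    then show "X = Y" using s V(2) unfolding partition_on_def disjoint_def by (metis disjoint_iff)
  qed
  then show ?thesis using s V by (intro card_inj_on_le[of s]) auto
qed

lemma refines_card_le:
  assumes "finite V" "refines V P Q"
  shows "card Q \<le> card P"
proof -
  have P: "partition_on V P" and Q: "partition_on V Q" using assms(2) by (auto simp: refines_def)
  have "\<forall>X\<in>P. \<exists>v. v \<in> X" using P by (metis partition_on_def ex_in_conv)
  then obtain s where s: "\<forall>X\<in>P. s X \<in> X" by metis
  have "card Q \<le> card (s ` P)"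
  proof (rule card_blocks_le_card[OF _ Q])
    show "finite (s ` P)" using finite_elements[OF assms(1) P] by simp
    fix v assume "v \<in> V"
    then obtain X where X: "X \<in> P" "v \<in> X" using P by (auto simp: partition_on_def)
    then have "related P v (s X)" using s by (auto simp: related_def)
    then show "\<exists>t\<in>s ` P. related Q v t" using X refines_relatedD[OF assms(2)] by blast
  qed
  also have "\<dots> \<le> card P" using finite_elements[OF assms(1) P] by (rule card_image_le)
  finally show ?thesis .
qed

text \<open>Two points lie in the same block of the least upper bound if and only if every common upper bound
  relates them.  An intersection of equivalence relations is an equivalence relation, so no transitive
  closure has to be formed.\<close>
lemma partition_lub_exists:
  assumes "partition_on V P" "partition_on V Q"
  shows "\<exists>J. refines V P J \<and> refines V Q J \<and> (\<forall>R. refines V P R \<and> refines V Q R \<longrightarrow> refines V J R)"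
proof -
  define U where "U = {R. refines V P R \<and> refines V Q R}"
  have part: "partition_on V R" if "R \<in> U" for R using that by (auto simp: U_def refines_def)
  define f where "f = (\<lambda>v. {u\<in>V. \<forall>R\<in>U. related R u v})"
  have f: "f u = f v \<longleftrightarrow> (\<forall>R\<in>U. related R u v)" if "u \<in> V" "v \<in> V" for u v
  proof
    assume "f u = f v"
    moreover have "u \<in> f u" using that related_refl[OF part] by (simp add: f_def)
    ultimately show "\<forall>R\<in>U. related R u v" by (auto simp: f_def)
  next
    assume "\<forall>R\<in>U. related R u v"
    then have "related R w u \<longleftrightarrow> related R w v" if "R \<in> U" for R w
      using that related_trans[OF part[OF that]] related_sym by metis
    then show "f u = f v" unfolding f_def by blast
  qed
  let ?J = "kernel_partition f V"
  have J: "refines V S ?J" if S: "partition_on V S" "\<And>R. R \<in> U \<Longrightarrow> refines V S R" for S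
  proof (rule refines_kernelI[OF S(1)])
    fix u v assume uv: "related S u v"
    then have "\<forall>R\<in>U. related R u v" using refines_relatedD[OF S(2)] by simp
    then show "f u = f v" using f related_in[OF S(1) uv] by simp
  qed
  have "refines V P ?J" "refines V Q ?J"
    using J[OF assms(1)] J[OF assms(2)] by (auto simp: U_def)
  moreover have "refines V ?J R" if "refines V P R \<and> refines V Q R" for R
  proof -
    have R: "R \<in> U" using that by (auto simp: U_def)
    then show ?thesis
      using f by (subst refines_iff_related[OF partition_on_kernel part[OF R]]) auto
  qed
  ultimately show ?thesis by blast
qed

text \<open>An elementary step in the partition lattice: joining two points costs at most one block, and
  exactly one if they were unrelated before.\<close>
lemma merge_blocks:
  assumes V: "finite V" "partition_on V P" and uv: "u \<in> V" "v \<in> V"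
  shows "\<exists>P'. refines V P P' \<and> related P' u v \<and>
    (\<forall>R. refines V P R \<longrightarrow> related R u v \<longrightarrow> refines V P' R) \<and>
    card P \<le> card P' + 1 \<and> (\<not> related P u v \<longrightarrow> card P' < card P)"
proof (cases "related P u v")
  case True
  then show ?thesis using refines_refl[OF V(2)] by (intro exI[of _ P]) auto
next
  case False
  obtain A B where A: "A \<in> P" "u \<in> A" and B: "B \<in> P" "v \<in> B"
    using V(2) uv by (auto simp: partition_on_def)
  have AB: "A \<noteq> B" using False A B by (auto simp: related_def)
  let ?Q = "insert (A \<union> B) (P - {A, B})"
  have Q: "partition_on V ?Q"
  proof (rule partition_onI)
    show "\<Union>?Q = V" using A B V(2) by (auto simp: partition_on_def)
    show "{} \<notin> ?Q" using A B V(2) by (auto simp: partition_on_def)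
    have dj: "X = Y \<or> disjnt X Y" if "X \<in> P" "Y \<in> P" for X Y
      using V(2) that by (auto simp: partition_on_def disjoint_def disjnt_def)
    show "disjnt X Y" if "X \<in> ?Q" "Y \<in> ?Q" "X \<noteq> Y" for X Y
      using that dj[of X Y] dj[of X A] dj[of X B] dj[of A Y] dj[of B Y] A(1) B(1)
      by auto
  qed
  have PQ: "refines V P ?Q" unfolding refines_def
  proof (intro conjI V(2) Q ballI)
    fix X assume "X \<in> P"
    then show "\<exists>Y\<in>?Q. X \<subseteq> Y" by (cases "X = A \<or> X = B") auto
  qed
  have fin: "finite P" using finite_elements V by blast
  have "A \<union> B \<notin> P"
    using False A(2) B(2) unfolding related_def by (metis UnI1 UnI2)
  then have cQ: "card ?Q = card (P - {A, B}) + 1" using fin by simp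
  have "card (P - {A, B}) = card P - 2" using fin A B AB by (subst card_Diff_subset) auto
  moreover have "card {A, B} \<le> card P" using fin A B by (intro card_mono) auto
  ultimately have card: "card P = card ?Q + 1" using cQ AB by simp
  have "refines V ?Q R" if R: "refines V P R" "related R u v" for R
  proof -
    have pR: "partition_on V R" using R(1) by (auto simp: refines_def)
    obtain C where C: "C \<in> R" "u \<in> C" "v \<in> C" using R(2) by (auto simp: related_def)
    have sub: "X \<subseteq> C" if X: "X \<in> P" and w: "w \<in> X" "w \<in> C" for X w
    proof
      fix t assume "t \<in> X"
      then have "related R w t" using refines_relatedD[OF R(1)] X w by (auto simp: related_def)
      then show "t \<in> C" using related_same_block[OF pR C(1) w(2)] by blast
    qed
    have "A \<union> B \<subseteq> C" using sub[of A u] sub[of B v] A B C by simp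
    moreover have "\<exists>Y\<in>R. X \<subseteq> Y" if "X \<in> P" for X using R(1) that by (auto simp: refines_def)
    ultimately show ?thesis using Q pR C(1) unfolding refines_def by auto
  qed
  moreover have "related ?Q u v" using A B by (auto simp: related_def)
  ultimately show ?thesis using PQ card by (intro exI[of _ ?Q]) auto
qed

section \<open>Joins of partitions and semimodularity\<close>

abbreviation (input) pjoin :: "nat \<Rightarrow> nat set set \<Rightarrow> nat set set \<Rightarrow> nat set set" where
  "pjoin n x y \<equiv> x \<squnion>\<^bsub>partition_order n\<^esub> y"

lemma pjoin:
  assumes "partition_on {1..n} x" "partition_on {1..n} y"
  shows "refines {1..n} x (pjoin n x y)" "refines {1..n} y (pjoin n x y)"
    "\<And>R. refines {1..n} x R \<Longrightarrow> refines {1..n} y R \<Longrightarrow> refines {1..n} (pjoin n x y) R"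
proof -
  let ?L = "partition_order n"
  have "Upper ?L {x, y} = {R. refines {1..n} x R \<and> refines {1..n} y R}"
    using assms refines_partition_on unfolding Upper_def partition_order_def by auto
  then have least_iff: "least ?L J (Upper ?L {x, y}) \<longleftrightarrow> refines {1..n} x J \<and> refines {1..n} y J \<and>
      (\<forall>R. refines {1..n} x R \<and> refines {1..n} y R \<longrightarrow> refines {1..n} J R)" for J
    using refines_partition_on[of "{1..n}" x] unfolding least_def by (auto simp: partition_order_def)
  have "least ?L (pjoin n x y) (Upper ?L {x, y})"
    unfolding join_def sup_def
    by (rule someI_ex) (use partition_lub_exists[OF assms] least_iff in blast)
  then show "refines {1..n} x (pjoin n x y)" "refines {1..n} y (pjoin n x y)"
    "\<And>R. refines {1..n} x R \<Longrightarrow> refines {1..n} y R \<Longrightarrow> refines {1..n} (pjoin n x y) R"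
    unfolding least_iff by blast+
qed

lemma partition_on_pjoin:
  assumes "partition_on {1..n} x" "partition_on {1..n} y"
  shows "partition_on {1..n} (pjoin n x y)"
  using pjoin(1)[OF assms] by (auto simp: refines_def)

lemma refines_imp_pjoin:
  assumes "refines {1..n} x y"
  shows "pjoin n x y = y"
proof -
  have x: "partition_on {1..n} x" and y: "partition_on {1..n} y" using assms by (auto simp: refines_def)
  show ?thesis
    by (rule refines_asym[OF pjoin(3)[OF x y assms refines_refl[OF y]] pjoin(2)[OF x y]])
qed

lemma pjoin_comm:
  assumes "partition_on {1..n} x" "partition_on {1..n} y"
  shows "pjoin n x y = pjoin n y x"
  by (rule refines_asym[OF pjoin(3)[OF assms pjoin(2,1)[OF assms(2,1)]]
        pjoin(3)[OF assms(2,1) pjoin(2,1)[OF assms]]])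

lemma pjoin_assoc:
  assumes "partition_on {1..n} x" "partition_on {1..n} y" "partition_on {1..n} z"
  shows "pjoin n (pjoin n x y) z = pjoin n x (pjoin n y z)"
proof -
  note xy = pjoin[OF assms(1,2)] and yz = pjoin[OF assms(2,3)]
  note l = pjoin[OF partition_on_pjoin[OF assms(1,2)] assms(3)]
  note r = pjoin[OF assms(1) partition_on_pjoin[OF assms(2,3)]]
  show ?thesis
  proof (rule refines_asym)
    show "refines {1..n} (pjoin n (pjoin n x y) z) (pjoin n x (pjoin n y z))"
      by (intro l(3) xy(3) r(1) refines_trans[OF yz(1) r(2)] refines_trans[OF yz(2) r(2)])
    show "refines {1..n} (pjoin n x (pjoin n y z)) (pjoin n (pjoin n x y) z)"
      by (intro r(3) yz(3) l(2) refines_trans[OF xy(1) l(1)] refines_trans[OF xy(2) l(1)])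
  qed
qed

lemma partition_bottom: "\<bottom>\<^bsub>partition_order n\<^esub> = kernel_partition id {1..n}"
proof -
  have r: "refines {1..n} (kernel_partition id {1..n}) x" if "partition_on {1..n} x" for x
    using that by (subst refines_iff_related) (auto simp: partition_on_kernel related_refl)
  then have "least (partition_order n) (kernel_partition id {1..n}) (carrier (partition_order n))"
    by (auto simp: least_def partition_order_def partition_on_kernel)
  moreover have "x = kernel_partition id {1..n}"
    if "least (partition_order n) x (carrier (partition_order n))" for x
    by (rule refines_asym[of "{1..n}"]) (use that r[of x] in
        \<open>auto simp: least_def partition_order_def partition_on_kernel\<close>)
  ultimately show ?thesis unfolding bottom_def by (rule some_equality)
qed

lemma partition_top: "\<top>\<^bsub>partition_order n\<^esub> = kernel_partition (\<lambda>_. ()) {1..n}"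
proof -
  have r: "refines {1..n} x (kernel_partition (\<lambda>_. ()) {1..n})" if "partition_on {1..n} x" for x
    using that by (intro refines_kernelI) auto
  then have "greatest (partition_order n) (kernel_partition (\<lambda>_. ()) {1..n}) (carrier (partition_order n))"
    by (auto simp: greatest_def partition_order_def partition_on_kernel)
  moreover have "x = kernel_partition (\<lambda>_. ()) {1..n}"
    if "greatest (partition_order n) x (carrier (partition_order n))" for x
    by (rule refines_asym[of "{1..n}"]) (use that r[of x] in
        \<open>auto simp: greatest_def partition_order_def partition_on_kernel\<close>)
  ultimately show ?thesis unfolding top_def by (rule some_equality)
qed

lemma card_partition_bottom: "card (\<bottom>\<^bsub>partition_order n\<^esub>) = n"
proof -
  have "kernel_partition id {1..n} = (\<lambda>v. {v}) ` {1..n}"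
    by (auto simp: kernel_partition_def)
  then show ?thesis unfolding partition_bottom by (simp add: card_image)
qed

lemma card_partition_top: "n \<ge> 1 \<Longrightarrow> card (\<top>\<^bsub>partition_order n\<^esub>) = 1"
proof -
  assume "n \<ge> 1"
  then have "kernel_partition (\<lambda>_. ()) {1..n} = {{1..n}}"
    by (auto simp: kernel_partition_def)
  then show ?thesis unfolding partition_top by simp
qed

lemma refines_bottom: "partition_on {1..n} x \<Longrightarrow> refines {1..n} (\<bottom>\<^bsub>partition_order n\<^esub>) x"
  unfolding partition_bottom
  by (subst refines_iff_related) (auto simp: partition_on_kernel related_refl)

lemma refines_top: "partition_on {1..n} x \<Longrightarrow> refines {1..n} x (\<top>\<^bsub>partition_order n\<^esub>)"
  unfolding partition_top by (intro refines_kernelI) auto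

text \<open>Semimodularity of the partition lattice, with \<open>n - card x\<close> as rank.  The induction moves \<open>z\<close> up
  to \<open>y\<close> by elementary steps.  A step that merges two blocks of \<open>z\<close> merges at most two blocks of
  \<open>x\<close>, and it does not change the join of \<open>x\<close> and \<open>y\<close> because the two points are related in \<open>y\<close>.\<close>
lemma card_semimodular:
  assumes "refines {1..n} z x" "refines {1..n} z y"
  shows "card x + card y \<le> card (pjoin n x y) + card z"
  using assms
proof (induction "card z" arbitrary: z x rule: less_induct)
  case less
  have z: "partition_on {1..n} z" and x: "partition_on {1..n} x" and y: "partition_on {1..n} y"
    using less.prems by (auto simp: refines_def)
  show ?case
  proof (cases "refines {1..n} y z")
    case True
    then have "y = z" by (rule refines_asym[OF _ less.prems(2)])
    then show ?thesis using refines_imp_pjoin[OF less.prems(1)] pjoin_comm[OF x y] by simp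
  next
    case False
    then obtain u v where uv: "related y u v" "\<not> related z u v"
      using refines_iff_related[OF y z] by blast
    have V: "u \<in> {1..n}" "v \<in> {1..n}" using related_in[OF y uv(1)] by auto
    obtain z' where z': "refines {1..n} z z'" "related z' u v"
      "\<And>R. refines {1..n} z R \<Longrightarrow> related R u v \<Longrightarrow> refines {1..n} z' R" "card z' < card z"
      using merge_blocks[OF finite_atLeastAtMost z V] uv(2) by auto
    obtain x' where x': "refines {1..n} x x'" "related x' u v"
      "\<And>R. refines {1..n} x R \<Longrightarrow> related R u v \<Longrightarrow> refines {1..n} x' R"
      "card x \<le> card x' + 1"
      using merge_blocks[OF finite_atLeastAtMost x V] by auto
    have px': "partition_on {1..n} x'" using x'(1) by (auto simp: refines_def)
    have "refines {1..n} z' x'" by (rule z'(3)[OF refines_trans[OF less.prems(1) x'(1)] x'(2)])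
    moreover have "refines {1..n} z' y" by (rule z'(3)[OF less.prems(2) uv(1)])
    ultimately have IH: "card x' + card y \<le> card (pjoin n x' y) + card z'"
      by (rule less.hyps[OF z'(4)])
    have "refines {1..n} (pjoin n x y) (pjoin n x' y)"
      by (rule pjoin(3)[OF x y refines_trans[OF x'(1) pjoin(1)[OF px' y]] pjoin(2)[OF px' y]])
    then have "card (pjoin n x' y) \<le> card (pjoin n x y)" by (rule refines_card_le[rotated]) simp
    then show ?thesis using IH x'(4) z'(4) by linarith
  qed
qed

definition nontrivial_blocks :: "'a set set \<Rightarrow> 'a set set" where
  "nontrivial_blocks P = {X\<in>P. \<exists>u\<in>X. \<exists>v\<in>X. u \<noteq> v}"

section \<open>Approximately modular partitions have few nontrivial blocks\<close>

lemma partition_on_blockE: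
  assumes "partition_on V P" "v \<in> V"
  obtains X where "X \<in> P" "v \<in> X"
  using partition_onD1[OF assms(1)] assms(2) that by blast

lemma nontrivial_blockI:
  assumes "related P u v" "u \<noteq> v"
  shows "u \<in> \<Union>(nontrivial_blocks P)"
  using assms by (auto simp: related_def nontrivial_blocks_def)

lemma merge_pairs:
  assumes V: "finite V" "partition_on V P" and "finite E" "E \<subseteq> V \<times> V"
  shows "\<exists>R. refines V P R \<and> (\<forall>(u, v)\<in>E. related R u v) \<and> card P \<le> card R + card E"
  using assms(3,4)
proof (induction E rule: finite_induct)
  case empty
  then show ?case using refines_refl[OF V(2)] by auto
next
  case (insert e E)
  then obtain R where R: "refines V P R" "\<forall>(u, v)\<in>E. related R u v" "card P \<le> card R + card E"
    by auto
  obtain u v where e: "e = (u, v)" "u \<in> V" "v \<in> V" using insert.prems by auto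
  have "partition_on V R" using R(1) by (simp add: refines_def)
  then obtain R' where R': "refines V R R'" "related R' u v" "card R \<le> card R' + 1"
    using merge_blocks[OF V(1) _ e(2,3)] by blast
  have "\<forall>(u, v)\<in>E. related R' u v" using R(2) refines_relatedD[OF R'(1)] by auto
  moreover have "refines V P R'" by (rule refines_trans[OF R(1) R'(1)])
  moreover have "card P \<le> card R' + card (insert e E)" using R(3) R'(3) insert.hyps by simp
  ultimately show ?case using R'(2) e(1) by (intro exI[of _ R']) auto
qed

text \<open>Every new block of \<open>Q\<close> contains at least two blocks of \<open>P\<close>, so if \<open>Q\<close> has almost as many blocks
  as \<open>P\<close>, then almost all blocks of \<open>P\<close> are blocks of \<open>Q\<close>.\<close>
lemma card_changed_blocks:
  assumes V: "finite V" and ref: "refines V P Q"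
  shows "card (P - Q) + 2 * card Q \<le> 2 * card P"
proof -
  have P: "partition_on V P" and Q: "partition_on V Q" using ref by (auto simp: refines_def)
  have fin: "finite P" "finite Q" using finite_elements[OF V] P Q by auto
  have two: "\<exists>X Y. X \<in> P \<and> Y \<in> P \<and> X \<subseteq> W \<and> Y \<subseteq> W \<and> X \<noteq> Y" if W: "W \<in> Q - P" for W
  proof -
    have part: "partition_on W {X\<in>P. X \<subseteq> W}"
      using refines_obtains_subset[OF ref] W by simp
    have "W \<noteq> {}" using W Q by (auto simp: partition_on_def)
    then obtain w where "w \<in> W" by blast
    then obtain X where X: "X \<in> P" "X \<subseteq> W" "w \<in> X" using part by (auto simp: partition_on_def)
    then have "X \<noteq> W" using W by auto
    then obtain w' where "w' \<in> W" "w' \<notin> X" using X(2) by blast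
    then obtain Y where "Y \<in> P" "Y \<subseteq> W" "w' \<in> Y" using part by (auto simp: partition_on_def)
    then show ?thesis using X \<open>w' \<notin> X\<close> by blast
  qed
  obtain p q where pq: "\<And>W. W \<in> Q - P \<Longrightarrow>
      p W \<in> P \<and> q W \<in> P \<and> p W \<subseteq> W \<and> q W \<subseteq> W \<and> p W \<noteq> q W" using two by metis
  have same: "W = W'" if "X \<in> P" "X \<subseteq> W" "X \<subseteq> W'" "W \<in> Q" "W' \<in> Q" for X W W'
  proof -
    have "X \<noteq> {}" using that P by (auto simp: partition_on_def)
    then show ?thesis using that disjointD[OF partition_onD2[OF Q], of W W'] by blast
  qed
  have notQ: "X \<notin> Q" if "X \<in> P" "X \<subseteq> W" "W \<in> Q - P" for X W
    using same[of X X W] that by auto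
  have inj_choice: "inj_on r (Q - P)" if r: "\<And>W. W \<in> Q - P \<Longrightarrow> r W \<in> P \<and> r W \<subseteq> W" for r
  proof (rule inj_onI)
    fix W W' assume "W \<in> Q - P" "W' \<in> Q - P" "r W = r W'"
    then show "W = W'" using same[of "r W" W W'] r[of W] r[of W'] by simp
  qed
  have inj: "inj_on p (Q - P)" "inj_on q (Q - P)"
    using inj_choice[of p] inj_choice[of q] pq by simp_all
  have "p ` (Q - P) \<inter> q ` (Q - P) = {}"
  proof (rule ccontr)
    assume "\<not> ?thesis"
    then obtain W W' where W: "W \<in> Q - P" "W' \<in> Q - P" "p W = q W'" by auto
    then have "W = W'" using same[of "p W" W W'] pq[OF W(1)] pq[OF W(2)] by auto
    then show False using W pq by blast
  qed
  then have "2 * card (Q - P) = card (p ` (Q - P) \<union> q ` (Q - P))"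
    using fin inj by (simp add: card_Un_disjoint card_image)
  also have "\<dots> \<le> card (P - Q)"
  proof (rule card_mono)
    show "finite (P - Q)" using fin by simp
    show "p ` (Q - P) \<union> q ` (Q - P) \<subseteq> P - Q" using pq notQ by blast
  qed
  finally have "2 * card (Q - P) \<le> card (P - Q)" .
  moreover have "card P = card (P - Q) + card (P \<inter> Q)"
    using card_Int_Diff[OF fin(1), of Q] by simp
  moreover have "card Q = card (Q - P) + card (P \<inter> Q)"
    using card_Int_Diff[OF fin(2), of P] by (simp add: Int_commute)
  ultimately show ?thesis by linarith
qed

text \<open>The nontrivial blocks of \<open>x\<close> are grouped into \<open>m\<close> pairs.  From each pair of blocks \<open>C\<close>, \<open>C'\<close> choose
  distinct points \<open>a\<close>, \<open>b\<close> of \<open>C\<close> and \<open>a'\<close>, \<open>b'\<close> of \<open>C'\<close>, and let \<open>y\<close> be the partition with the blocks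
  \<open>{a, a'}\<close> and \<open>{b, b'}\<close> for all pairs.  Then \<open>y\<close> has rank \<open>2 * m\<close>, but joining it to \<open>x\<close> adds only \<open>m\<close>
  to the rank, because the second pair of points becomes superfluous.  An approximate meet \<open>z\<close> of \<open>x\<close> and
  \<open>y\<close> therefore has rank at least \<open>m\<close> up to \<open>D\<close>.  As the blocks of \<open>y\<close> have at most two points and
  \<open>z\<close> is almost below \<open>y\<close>, nearly all of this rank comes from two-point blocks of \<open>y\<close> that \<open>z\<close> joins.
  But each of them connects two different blocks of \<open>x\<close>, and \<open>z\<close> is almost below \<open>x\<close>; so their number,
  and with it \<open>m\<close>, is bounded by a multiple of \<open>D\<close>.\<close>
lemma few_nontrivial_blocks:
  fixes D :: real
  assumes x: "partition_on {1..n} x"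
    and mod: "\<And>y. partition_on {1..n} y \<Longrightarrow> \<exists>z. partition_on {1..n} z \<and>
      real (card (pjoin n x y)) + real (card z) \<le> real (card x) + real (card y) + D \<and>
      real (card x) \<le> real (card (pjoin n z x)) + D \<and> real (card y) \<le> real (card (pjoin n z y)) + D"
  shows "real (card (nontrivial_blocks x)) \<le> 14 * D + 1"
proof -
  let ?V = "{1..n}"
  define k where "k = card (nontrivial_blocks x)"
  define m where "m = k div 2"
  have finx: "finite x" by (rule finite_elements[OF _ x]) simp
  then have "finite (nontrivial_blocks x)" by (auto simp: nontrivial_blocks_def)
  then obtain C where C: "bij_betw C {..<k} (nontrivial_blocks x)"
    unfolding k_def by (metis bij_betw_from_nat_into_finite)
  have Cx: "C i \<in> x" "\<exists>u\<in>C i. \<exists>v\<in>C i. u \<noteq> v" if "i < k" for i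
    using bij_betwE[OF C] that by (auto simp: nontrivial_blocks_def)
  then have "\<exists>u v. u \<in> C i \<and> v \<in> C i \<and> u \<noteq> v" if "i < k" for i using that by blast
  then obtain a b where ab: "\<And>i. i < k \<Longrightarrow> a i \<in> C i \<and> b i \<in> C i \<and> a i \<noteq> b i" by metis
  have CV: "u \<in> ?V" if "i < k" "u \<in> C i" for u i
    using Cx(1)[OF that(1)] that x by (auto simp: partition_on_def)
  have Cinj: "i = j" if "i < k" "j < k" "u \<in> C i" "u \<in> C j" for i j u
  proof -
    have "C i = C j"
      using disjointD[OF partition_onD2[OF x], of "C i" "C j"] Cx that by blast
    then show ?thesis using that bij_betw_imp_inj_on[OF C] by (auto dest: inj_onD)
  qed
  \<comment> \<open>The two-point blocks of \<open>y\<close> are \<open>{s j, t j}\<close> for \<open>j\<close> in \<open>J\<close>; the flag tells the pair \<open>a\<close>, \<open>a'\<close> from the pair \<open>b\<close>, \<open>b'\<close>.\<close>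
  define J where "J = {..<m} \<times> (UNIV :: bool set)"
  define s where "s = (\<lambda>(i, c). if c then a (2 * i) else b (2 * i))"
  define t where "t = (\<lambda>(i, c). if c then a (2 * i + 1) else b (2 * i + 1))"
  have J: "finite J" "card J = 2 * m" by (auto simp: J_def card_cartesian_product)
  have km: "2 * i + 1 < k" "2 * i < k" if "i < m" for i using that by (auto simp: m_def)
  have sC: "s (i, c) \<in> C (2 * i)" and tC: "t (i, c) \<in> C (2 * i + 1)" if "i < m" for i c
    using ab km[OF that] by (auto simp: s_def t_def)
  have sV: "s j \<in> ?V" and tV: "t j \<in> ?V" if "j \<in> J" for j
    using that by (cases j; use CV[OF km(2) sC] CV[OF km(1) tC] in \<open>auto simp: J_def\<close>)+
  have sinj: "inj_on s J"
  proof (rule inj_onI)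
    fix p q assume "p \<in> J" "q \<in> J" "s p = s q"
    moreover obtain i c where "p = (i, c)" by (cases p)
    moreover obtain j d where "q = (j, d)" by (cases q)
    moreover from calculation have "i = j"
      using Cinj[of "2 * i" "2 * j" "s p"] km sC[of i c] sC[of j d] by (simp add: J_def)
    ultimately show "p = q"
      using ab[OF km(2), of i] by (auto simp: J_def s_def split: if_splits)
  qed
  have tinj: "inj_on t J"
  proof (rule inj_onI)
    fix p q assume "p \<in> J" "q \<in> J" "t p = t q"
    moreover obtain i c where "p = (i, c)" by (cases p)
    moreover obtain j d where "q = (j, d)" by (cases q)
    moreover from calculation have "i = j"
      using Cinj[of "2 * i + 1" "2 * j + 1" "t p"] km tC[of i c] tC[of j d] by (simp add: J_def)
    ultimately show "p = q"
      using ab[OF km(1), of i] by (auto simp: J_def t_def split: if_splits)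
  qed
  have st: "s p \<noteq> t q" if pq: "p \<in> J" "q \<in> J" for p q
  proof
    assume eq: "s p = t q"
    obtain i c where p: "p = (i, c)" by (cases p)
    obtain j d where q: "q = (j, d)" by (cases q)
    have "i < m" "j < m" using pq p q by (auto simp: J_def)
    then have "2 * i = 2 * j + 1"
      using Cinj[of "2 * i" "2 * j + 1" "s p"] km sC[of i c] tC[of j d] eq p q by simp
    then show False by presburger
  qed
  \<comment> \<open>The retraction whose fibres are the blocks of \<open>y\<close>.\<close>
  define f where "f = (\<lambda>v. if v \<in> t ` J then s (inv_into J t v) else v)"
  have ft: "f (t j) = s j" if "j \<in> J" for j using that tinj by (simp add: f_def)
  have fid: "f v = v" if "v \<notin> t ` J" for v using that by (simp add: f_def)
  have fV: "f v \<in> ?V - t ` J" if "v \<in> ?V" for v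
    using that sV st by (cases "v \<in> t ` J") (auto simp: ft fid)
  have ff: "f (f v) = f v" if "v \<in> ?V" for v using fV[OF that] fid by auto
  define y where "y = kernel_partition f ?V"
  have y: "partition_on ?V y" unfolding y_def by (rule partition_on_kernel)
  have rely: "related y u v \<longleftrightarrow> u \<in> ?V \<and> v \<in> ?V \<and> f u = f v" for u v by (simp add: y_def)
  have fcases: "u = v \<or> (\<exists>j\<in>J. (u = t j \<and> v = s j) \<or> (v = t j \<and> u = s j))" if "f u = f v" for u v
  proof -
    have c: "(v = f v \<and> v \<notin> t ` J) \<or> (\<exists>j\<in>J. v = t j \<and> f v = s j)" for v
      using ft fid by (cases "v \<in> t ` J") auto
    consider "u = f u" "v = f v" | j where "u = f u" "j \<in> J" "v = t j" "f v = s j"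
      | j where "v = f v" "j \<in> J" "u = t j" "f u = s j"
      | i j where "i \<in> J" "j \<in> J" "u = t i" "f u = s i" "v = t j" "f v = s j"
      using c[of u] c[of v] by blast
    then show ?thesis
    proof cases
      case 4
      then have "i = j" using that inj_onD[OF sinj, of i j] by simp
      then show ?thesis using 4 by simp
    qed (use that in auto)
  qed
  have cardT: "card (?V - t ` J) + 2 * m = n"
  proof -
    have "t ` J \<subseteq> ?V" using tV by blast
    then have "card (t ` J) \<le> card ?V" "card (?V - t ` J) = card ?V - card (t ` J)"
      using J(1) by (auto intro: card_mono simp only: card_Diff_subset finite_imageI finite_atLeastAtMost)
    moreover have "card (t ` J) = 2 * m" using J tinj by (simp add: card_image)
    ultimately show ?thesis by simp
  qed
  have cy: "card y \<le> card (?V - t ` J)"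
  proof (rule card_blocks_le_card[OF _ y])
    fix v assume v: "v \<in> ?V"
    then have "related y v (f v)" using fV[OF v] ff[OF v] by (auto simp: rely)
    then show "\<exists>s\<in>?V - t ` J. related y v s" using fV[OF v] by blast
  qed simp
  \<comment> \<open>Merging \<open>a\<close> with \<open>a'\<close> for all pairs of blocks also relates \<open>b\<close> to \<open>b'\<close>.\<close>
  have cxy: "card x \<le> card (pjoin n x y) + m"
  proof -
    let ?E = "(\<lambda>i. (a (2 * i), a (2 * i + 1))) ` {..<m}"
    have "?E \<subseteq> ?V \<times> ?V" using ab km CV by blast
    then obtain R where R: "refines ?V x R" "\<forall>(u, v)\<in>?E. related R u v" "card x \<le> card R + card ?E"
      using merge_pairs[OF _ x, of ?E] by auto
    have pR: "partition_on ?V R" using R(1) by (simp add: refines_def)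
    have a: "related R (a (2 * i)) (a (2 * i + 1))" if "i < m" for i using R(2) that by auto
    have ab': "related R (a i) (b i)" if "i < k" for i
      using ab[OF that] Cx(1)[OF that] refines_relatedD[OF R(1)] by (auto simp: related_def)
    have b: "related R (b (2 * i)) (b (2 * i + 1))" if "i < m" for i
      using related_trans[OF pR related_trans[OF pR related_sym[OF ab'] a] ab'] that km by auto
    have Rst: "related R (t j) (s j)" if "j \<in> J" for j
      using that a b related_sym[of R] by (cases j) (auto simp: J_def s_def t_def)
    have Rf: "related R v (f v)" if "v \<in> ?V" for v
      using that Rst related_refl[OF pR that] by (cases "v \<in> t ` J") (auto simp: ft fid)
    have "refines ?V y R"
    proof (subst refines_iff_related[OF y pR], intro allI impI)
      fix u v assume "related y u v"
      then show "related R u v"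
        using Rf[of u] Rf[of v] related_trans[OF pR, of u "f u" v] related_sym[of R v "f v"]
        by (auto simp: rely)
    qed
    then have "card R \<le> card (pjoin n x y)"
      by (intro refines_card_le[OF _ pjoin(3)[OF x y R(1)]]) simp
    moreover have "card ?E \<le> m" using card_image_le[of "{..<m}"] by simp
    ultimately show ?thesis using R(3) by linarith
  qed
  obtain z where z: "partition_on ?V z"
    and z1: "real (card (pjoin n x y)) + real (card z) \<le> real (card x) + real (card y) + D"
    and z2: "real (card x) \<le> real (card (pjoin n z x)) + D"
    and z3: "real (card y) \<le> real (card (pjoin n z y)) + D"
    using mod[OF y] by blast
  \<comment> \<open>The blocks of \<open>y\<close> that \<open>z\<close> joins.\<close>
  define G where "G = {j\<in>J. related z (s j) (t j)}"
  have finG: "finite G" using J by (auto simp: G_def)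
  \<comment> \<open>Each pair of blocks of \<open>x\<close> is joined by at most two elements of \<open>G\<close>, and disjoint pairs lower the number of blocks independently.\<close>
  have good_few: "2 * card (pjoin n z x) + card G \<le> 2 * card x"
  proof -
    let ?w = "pjoin n z x"
    note w = pjoin[OF z x]
    have pw: "partition_on ?V ?w" by (rule partition_on_pjoin[OF z x])
    define I where "I = fst ` G"
    have Im: "I \<subseteq> {..<m}" by (auto simp: I_def G_def J_def)
    have "G \<subseteq> I \<times> UNIV" by (force simp: I_def)
    then have "card G \<le> card (I \<times> (UNIV :: bool set))"
      using finG by (intro card_mono) (auto simp: I_def)
    then have GI: "card G \<le> 2 * card I" by (simp add: card_cartesian_product)
    let ?O = "(\<lambda>i. C (2 * i + 1)) ` I"
    have cO: "card ?O = card I"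
    proof (rule card_image, rule inj_onI)
      fix i j assume ij: "i \<in> I" "j \<in> I" and eq: "C (2 * i + 1) = C (2 * j + 1)"
      have k: "2 * i + 1 < k" "2 * j + 1 < k" using ij Im km(1) by auto
      have "a (2 * i + 1) \<in> C (2 * i + 1)" using ab[OF k(1)] by simp
      then show "i = j" using Cinj[OF k, of "a (2 * i + 1)"] eq by simp
    qed
    have Ox: "?O \<subseteq> x" using Cx km Im by auto
    have "\<forall>X\<in>x. \<exists>v. v \<in> X" using x by (metis partition_on_def ex_in_conv)
    then obtain r where r: "\<forall>X\<in>x. r X \<in> X" by metis
    have same: "related ?w u v" if "X \<in> x" "u \<in> X" "v \<in> X" for X u v
    proof (rule refines_relatedD[OF w(2)])
      show "related x u v" using that unfolding related_def by blast
    qed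
    have rr: "related ?w v (r X)" if "X \<in> x" "v \<in> X" for X v
      using same[OF that] r that(1) by simp
    have "card ?w \<le> card (r ` (x - ?O))"
    proof (rule card_blocks_le_card[OF _ pw])
      show "finite (r ` (x - ?O))" using finx by simp
      fix v assume "v \<in> ?V"
      then obtain X where X: "X \<in> x" "v \<in> X" by (rule partition_on_blockE[OF x])
      show "\<exists>u\<in>r ` (x - ?O). related ?w v u"
      proof (cases "X \<in> ?O")
        case False
        then show ?thesis using rr[OF X] X by blast
      next
        case True
        then obtain i where i: "i \<in> I" "X = C (2 * i + 1)" by blast
        then obtain c where c: "(i, c) \<in> G" by (auto simp: I_def)
        have im: "i < m" using i Im by auto
        have "related z (s (i, c)) (t (i, c))" using c by (simp add: G_def)
        then have "related ?w (t (i, c)) (s (i, c))"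
          by (rule related_sym[OF refines_relatedD[OF w(1)]])
        moreover have "related ?w v (t (i, c))"
          using same[OF X] i(2) tC[OF im] by simp
        moreover have "related ?w (s (i, c)) (r (C (2 * i)))"
          using rr[OF Cx(1)[OF km(2)[OF im]] sC[OF im]] .
        ultimately have "related ?w v (r (C (2 * i)))" using related_trans[OF pw] by blast
        moreover have "C (2 * i) \<notin> ?O"
        proof
          assume "C (2 * i) \<in> ?O"
          then obtain j where j: "j \<in> I" "C (2 * i) = C (2 * j + 1)" by blast
          have k: "2 * i < k" "2 * j + 1 < k" using im j(1) Im km by auto
          have "a (2 * i) \<in> C (2 * i)" using ab[OF k(1)] by simp
          then have "2 * i = 2 * j + 1" using Cinj[OF k, of "a (2 * i)"] j(2) by simp
          then show False by presburger
        qed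
        ultimately show ?thesis using Cx(1)[OF km(2)[OF im]] by blast
      qed
    qed
    also have "\<dots> \<le> card (x - ?O)" using finx by (intro card_image_le) simp
    also have "\<dots> = card x - card I" using Ox finx cO by (simp add: card_Diff_subset finite_subset)
    finally have "card ?w \<le> card x - card I" .
    moreover have "card I \<le> card x" using card_mono[OF finx Ox] cO by simp
    ultimately show ?thesis using GI by linarith
  qed
  \<comment> \<open>Outside the blocks of \<open>y\<close> that are enlarged by \<open>z\<close>, the only points related by \<open>z\<close> are \<open>s j\<close> and \<open>t j\<close> with \<open>j\<close> in \<open>G\<close>.\<close>
  have many: "n \<le> card z + 2 * card (y - pjoin n z y) + card G"
  proof -
    let ?w = "pjoin n z y"
    note w = pjoin[OF z y]
    have pw: "partition_on ?V ?w" by (rule partition_on_pjoin[OF z y])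
    let ?U = "\<Union>(y - ?w)"
    have finy: "finite y" by (rule finite_elements[OF _ y]) simp
    have "card Y \<le> 2" if Y: "Y \<in> y" for Y
    proof -
      obtain v where v: "v \<in> ?V" "Y = {u\<in>?V. f u = f v}"
        using Y by (auto simp: y_def kernel_partition_def)
      have "Y \<subseteq> {f v, t (inv_into J s (f v))}"
      proof
        fix u assume "u \<in> Y"
        then have fu: "f u = f v" using v by simp
        show "u \<in> {f v, t (inv_into J s (f v))}"
        proof (cases "u \<in> t ` J")
          case True
          then obtain j where "j \<in> J" "u = t j" by blast
          then show ?thesis using fu[symmetric] ft sinj by simp
        next
          case False
          then show ?thesis using fid fu by simp
        qed
      qed
      then have "card Y \<le> card {f v, t (inv_into J s (f v))}" by (intro card_mono) auto
      also have "\<dots> \<le> 2" by (simp add: card_insert_if)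
      finally show ?thesis .
    qed
    then have "(\<Sum>Y\<in>y - ?w. card Y) \<le> (\<Sum>Y\<in>y - ?w. 2)" by (intro sum_mono) auto
    then have cU: "card ?U \<le> 2 * card (y - ?w)"
      using card_Union_le_sum_card[of "y - ?w"] by simp
    let ?S = "?V - ?U - t ` G"
    have "card ?S \<le> card z"
    proof (rule card_le_card_blocks[OF _ z])
      fix u v assume u: "u \<in> ?S" and v: "v \<in> ?S" and uv: "related z u v"
      obtain Y where Y: "Y \<in> y" "u \<in> Y" by (rule partition_on_blockE[OF y, of u]) (use u in blast)
      then have "Y \<in> ?w" using u by blast
      then have "v \<in> Y" using related_same_block[OF pw _ Y(2)] refines_relatedD[OF w(1) uv] by blast
      then have "related y u v" using Y by (auto simp: related_def)
      then have "f u = f v" by (simp add: rely)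
      then consider "u = v" | j where "j \<in> J" "u = t j" "v = s j" | j where "j \<in> J" "v = t j" "u = s j"
        using fcases by blast
      then show "u = v"
      proof cases
        case 2
        then have "j \<in> G" using uv related_sym by (auto simp: G_def)
        then show ?thesis using 2 u by blast
      next
        case 3
        then have "j \<in> G" using uv by (auto simp: G_def)
        then show ?thesis using 3 v by blast
      qed
    qed auto
    moreover have "n \<le> card ?S + card ?U + card (t ` G)"
    proof -
      have "?V \<subseteq> ?S \<union> ?U \<union> t ` G" by blast
      moreover have "finite ?U"
        using partition_onD1[OF y] by (intro finite_subset[OF _ finite_atLeastAtMost[of 1 n]]) blast
      ultimately have "card ?V \<le> card (?S \<union> ?U \<union> t ` G)" using finG by (intro card_mono) auto
      also have "\<dots> \<le> card (?S \<union> ?U) + card (t ` G)" by (rule card_Un_le)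
      also have "\<dots> \<le> card ?S + card ?U + card (t ` G)" using card_Un_le[of ?S ?U] by linarith
      finally show ?thesis by simp
    qed
    moreover have "card (t ` G) \<le> card G" using finG by (rule card_image_le)
    ultimately show ?thesis using cU by linarith
  qed
  have "card (y - pjoin n z y) + 2 * card (pjoin n z y) \<le> 2 * card y"
    by (rule card_changed_blocks[OF _ pjoin(2)[OF z y]]) simp
  then have c1: "real (card (y - pjoin n z y)) \<le> 2 * D" using z3 by linarith
  have c2: "real (card G) \<le> 2 * D" using good_few z2 by linarith
  have "real m \<le> 7 * D"
    using c1 c2 many cxy cy cardT z1 by linarith
  then show ?thesis unfolding k_def[symmetric] m_def by linarith
qed

section \<open>Collapsed sets and approximate complements\<close>

text \<open>The set \<open>B\<close> is collapsed to one block, all other blocks are singletons.  The label \<open>0\<close> of that block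
  is no point of \<open>{1..n}\<close>.\<close>
definition collapse :: "nat \<Rightarrow> nat set \<Rightarrow> nat set set" where
  "collapse n B = kernel_partition (\<lambda>v. if v \<in> B then 0 else v) {1..n}"

lemma partition_on_collapse: "partition_on {1..n} (collapse n B)"
  unfolding collapse_def by (rule partition_on_kernel)

lemma related_collapse:
  "related (collapse n B) u v \<longleftrightarrow> u \<in> {1..n} \<and> v \<in> {1..n} \<and> (u = v \<or> u \<in> B \<and> v \<in> B)"
  by (auto simp: collapse_def)

lemma card_collapse_ge: "card ({1..n} - B) \<le> card (collapse n B)"
  by (rule card_le_card_blocks[OF _ partition_on_collapse]) (auto simp: related_collapse)

lemma refines_collapse:
  assumes "partition_on {1..n} x" "\<Union>(nontrivial_blocks x) \<subseteq> B"
  shows "refines {1..n} x (collapse n B)"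
proof (subst refines_iff_related[OF assms(1) partition_on_collapse], intro allI impI)
  fix u v assume uv: "related x u v"
  show "related (collapse n B) u v"
    unfolding related_collapse
    using related_in[OF assms(1) uv] nontrivial_blockI[OF uv] nontrivial_blockI[OF related_sym[OF uv]] assms(2)
    by blast
qed

lemma refines_collapse_mono: "B \<subseteq> B' \<Longrightarrow> refines {1..n} (collapse n B) (collapse n B')"
  by (subst refines_iff_related[OF partition_on_collapse partition_on_collapse])
     (auto simp: related_collapse)

text \<open>Collapsed sets are modular: the meet \<open>z\<close> with \<open>w\<close> restricts the blocks of \<open>w\<close> to \<open>B\<close>, and the
  join glues together those blocks of \<open>w\<close> that meet \<open>B\<close>.  The summand \<open>1\<close> stands for the glued block:
  only the singletons of the collapse are counted on the right, so that empty \<open>B\<close> is covered as well.\<close>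
lemma collapse_meet:
  assumes w: "partition_on {1..n} w"
  shows "\<exists>z. refines {1..n} z (collapse n B) \<and> refines {1..n} z w \<and>
    card (pjoin n (collapse n B) w) + card z \<le> card (collapse n B) + card w + 1"
proof -
  let ?V = "{1..n}" and ?c = "collapse n B"
  define g where "g = (\<lambda>v. if v \<in> B then {u\<in>B. related w u v} else {v})"
  define z where "z = kernel_partition g ?V"
  have z: "partition_on ?V z" unfolding z_def by (rule partition_on_kernel)
  have g: "g u = g v \<longleftrightarrow> u = v \<or> u \<in> B \<and> v \<in> B \<and> related w u v"
    if "u \<in> ?V" "v \<in> ?V" for u v
  proof
    assume "g u = g v"
    moreover have "u \<in> g u" "v \<in> g v" using that related_refl[OF w] by (auto simp: g_def)
    ultimately show "u = v \<or> u \<in> B \<and> v \<in> B \<and> related w u v"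
      by (auto simp: g_def split: if_splits)
  next
    assume *: "u = v \<or> u \<in> B \<and> v \<in> B \<and> related w u v"
    have "related w t u \<longleftrightarrow> related w t v" if "related w u v" for t
      using that related_trans[OF w] related_sym by metis
    with * show "g u = g v" by (auto simp: g_def)
  qed
  have relz: "related z u v \<longleftrightarrow> u \<in> ?V \<and> v \<in> ?V \<and> (u = v \<or> u \<in> B \<and> v \<in> B \<and> related w u v)" for u v
    using g by (auto simp: z_def)
  have zc: "refines ?V z ?c"
    by (subst refines_iff_related[OF z partition_on_collapse]) (auto simp: relz related_collapse)
  have zw: "refines ?V z w"
    by (subst refines_iff_related[OF z w]) (auto simp: relz related_refl[OF w])
  let ?W = "{W\<in>w. W \<inter> B \<noteq> {}}"
  have finw: "finite w" by (rule finite_elements[OF _ w]) simp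
  have WV: "v \<in> ?V" if "W \<in> w" "v \<in> W" for W v using that partition_onD1[OF w] by blast
  have "\<forall>W\<in>?W. \<exists>v. v \<in> W \<inter> B" by blast
  then obtain r where r: "\<forall>W\<in>?W. r W \<in> W \<inter> B" by metis
  have "card z \<le> card ((?V - B) \<union> r ` ?W)"
  proof (rule card_blocks_le_card[OF _ z])
    fix v assume v: "v \<in> ?V"
    show "\<exists>s\<in>(?V - B) \<union> r ` ?W. related z v s"
    proof (cases "v \<in> B")
      case False
      then show ?thesis using v related_refl[OF z v] by blast
    next
      case True
      obtain W where W: "W \<in> w" "v \<in> W" by (rule partition_on_blockE[OF w v])
      then have W': "W \<in> ?W" using True by blast
      then have rW: "r W \<in> W" "r W \<in> B" using r by auto
      then have "related w v (r W)" using W unfolding related_def by blast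
      then have "related z v (r W)" using True v WV[OF W(1) rW(1)] rW(2) by (simp add: relz)
      then show ?thesis using W' by blast
    qed
  qed (use finw in auto)
  also have "\<dots> \<le> card (?V - B) + card (r ` ?W)" by (rule card_Un_le)
  also have "\<dots> \<le> card (?V - B) + card ?W" using finw by (simp add: card_image_le)
  finally have 1: "card z \<le> card (?V - B) + card ?W" .
  have "\<forall>W\<in>w. \<exists>v. v \<in> W" using partition_onD3[OF w] by (metis ex_in_conv)
  then obtain q where q: "\<forall>W\<in>w. q W \<in> W" by metis
  obtain b where b: "B \<inter> ?V \<noteq> {} \<Longrightarrow> b \<in> B \<inter> ?V" by blast
  note j = pjoin[OF partition_on_collapse[of n B] w]
  have "card (pjoin n ?c w) \<le> card (insert b (q ` (w - ?W)))"
  proof (rule card_blocks_le_card[OF _ partition_on_pjoin[OF partition_on_collapse w]])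
    fix v assume v: "v \<in> ?V"
    obtain W where W: "W \<in> w" "v \<in> W" by (rule partition_on_blockE[OF w v])
    show "\<exists>s\<in>insert b (q ` (w - ?W)). related (pjoin n ?c w) v s"
    proof (cases "W \<in> ?W")
      case False
      have "related w v (q W)" using W q unfolding related_def by blast
      then have "related (pjoin n ?c w) v (q W)" by (rule refines_relatedD[OF j(2)])
      then show ?thesis using False W(1) by blast
    next
      case True
      then obtain u where u: "u \<in> W" "u \<in> B" by blast
      have "u \<in> ?V" using WV[OF W(1) u(1)] .
      then have "related ?c u b" using b u(2) unfolding related_collapse by blast
      then have "related (pjoin n ?c w) u b" by (rule refines_relatedD[OF j(1)])
      moreover have "related w v u" using W u unfolding related_def by blast
      then have "related (pjoin n ?c w) v u" by (rule refines_relatedD[OF j(2)])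
      ultimately show ?thesis using related_trans[OF partition_on_pjoin[OF partition_on_collapse w]] by blast
    qed
  qed (use finw in auto)
  also have "\<dots> \<le> Suc (card (q ` (w - ?W)))" by (rule card_insert_le_m1) (use finw in auto)
  also have "\<dots> \<le> Suc (card (w - ?W))" using finw by (simp add: card_image_le)
  also have "card (w - ?W) = card w - card ?W" using finw by (intro card_Diff_subset) auto
  finally have 2: "card (pjoin n ?c w) \<le> Suc (card w - card ?W)" .
  have "card ?W \<le> card w" using finw by (intro card_mono) auto
  then have "card (pjoin n ?c w) + card z \<le> card ?c + card w + 1"
    using 1 2 card_collapse_ge[of n B] by linarith
  then show ?thesis using zc zw by blast
qed

context
  fixes n :: nat and x c :: "nat set set"
  assumes x: "partition_on {1..n} x"
  defines "c \<equiv> collapse n ({1..n} - \<Union>(nontrivial_blocks x))"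
begin

text \<open>The block of \<open>c\<close> together with the nontrivial blocks of \<open>x\<close> covers all points.\<close>
lemma card_join_complement: "card (pjoin n x c) \<le> card (nontrivial_blocks x) + 1"
proof -
  let ?V = "{1..n}" and ?N = "nontrivial_blocks x"
  have c: "partition_on ?V c" unfolding c_def by (rule partition_on_collapse)
  note j = pjoin[OF x c]
  have "finite x" by (rule finite_elements[OF _ x]) simp
  then have finN: "finite ?N" unfolding nontrivial_blocks_def by simp
  have N: "\<forall>X\<in>?N. X \<in> x \<and> (\<exists>v. v \<in> X)" unfolding nontrivial_blocks_def by blast
  then obtain r where r: "\<forall>X\<in>?N. r X \<in> X" by metis
  obtain b where b: "?V - \<Union>?N \<noteq> {} \<Longrightarrow> b \<in> ?V - \<Union>?N" by blast
  have "card (pjoin n x c) \<le> card (insert b (r ` ?N))"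
  proof (rule card_blocks_le_card[OF _ partition_on_pjoin[OF x c]])
    fix v assume v: "v \<in> ?V"
    show "\<exists>s\<in>insert b (r ` ?N). related (pjoin n x c) v s"
    proof (cases "v \<in> \<Union>?N")
      case True
      then obtain X where X: "X \<in> ?N" "v \<in> X" by blast
      then have "related x v (r X)" using r N unfolding related_def by blast
      then have "related (pjoin n x c) v (r X)" by (rule refines_relatedD[OF j(1)])
      then show ?thesis using X by blast
    next
      case False
      then have "related c v b" using v b unfolding c_def related_collapse by blast
      then have "related (pjoin n x c) v b" by (rule refines_relatedD[OF j(2)])
      then show ?thesis by blast
    qed
  qed (use finN in auto)
  also have "\<dots> \<le> Suc (card (r ` ?N))" by (rule card_insert_le_m1) (use finN in auto)
  also have "\<dots> \<le> Suc (card ?N)" using finN by (simp add: card_image_le)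
  finally show ?thesis by simp
qed

lemma card_complement_sum: "n \<le> card x + card c"
proof -
  let ?V = "{1..n}" and ?A = "\<Union>(nontrivial_blocks x)"
  have "card (?V - ?A) \<le> card x"
  proof (rule card_le_card_blocks[OF _ x])
    fix u v assume "u \<in> ?V - ?A" "related x u v"
    then show "u = v" using nontrivial_blockI[of x u v] by blast
  qed auto
  moreover have "card (?V - (?V - ?A)) \<le> card c" unfolding c_def by (rule card_collapse_ge)
  moreover have "(?V - ?A) \<union> (?V - (?V - ?A)) = ?V" by blast
  then have "card ?V \<le> card (?V - ?A) + card (?V - (?V - ?A))"
    using card_Un_le[of "?V - ?A" "?V - (?V - ?A)"] by simp
  ultimately show ?thesis by simp
qed

text \<open>Up to the number of nontrivial blocks this is the identity \<open>|A \<union> B| + |A\<^sup>c \<union> B| = n + |B|\<close> for the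
  unions \<open>A\<close> and \<open>B\<close> of the nontrivial blocks of \<open>x\<close> and \<open>y\<close>.  The joins lie below the collapses of
  \<open>A \<union> B\<close> and \<open>A\<^sup>c \<union> B\<close>.\<close>
lemma card_le_joins_complement:
  assumes y: "partition_on {1..n} y"
  shows "card y \<le> card (pjoin n x y) + card (pjoin n c y) + card (nontrivial_blocks y)"
proof -
  let ?V = "{1..n}" and ?A = "\<Union>(nontrivial_blocks x)" and ?N = "nontrivial_blocks y"
  let ?B = "\<Union>?N"
  have c: "partition_on ?V c" unfolding c_def by (rule partition_on_collapse)
  have "finite y" by (rule finite_elements[OF _ y]) simp
  then have finN: "finite ?N" unfolding nontrivial_blocks_def by simp
  have N: "\<forall>X\<in>?N. X \<in> y \<and> (\<exists>v. v \<in> X)" unfolding nontrivial_blocks_def by blast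
  then obtain r where r: "\<forall>X\<in>?N. r X \<in> X" by metis
  have "card y \<le> card ((?V - ?B) \<union> r ` ?N)"
  proof (rule card_blocks_le_card[OF _ y])
    fix v assume v: "v \<in> ?V"
    show "\<exists>s\<in>(?V - ?B) \<union> r ` ?N. related y v s"
    proof (cases "v \<in> ?B")
      case True
      then obtain X where X: "X \<in> ?N" "v \<in> X" by blast
      then have "related y v (r X)" using r N unfolding related_def by blast
      then show ?thesis using X by blast
    next
      case False
      then show ?thesis using related_refl[OF y v] v by blast
    qed
  qed (use finN in auto)
  also have "\<dots> \<le> card (?V - ?B) + card (r ` ?N)" by (rule card_Un_le)
  also have "\<dots> \<le> card (?V - ?B) + card ?N" using finN by (simp add: card_image_le)
  finally have 1: "card y \<le> card (?V - ?B) + card ?N" .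
  have "refines ?V (pjoin n x y) (collapse n (?A \<union> ?B))"
    by (rule pjoin(3)[OF x y refines_collapse[OF x] refines_collapse[OF y]]) auto
  then have "card (collapse n (?A \<union> ?B)) \<le> card (pjoin n x y)" by (rule refines_card_le[rotated]) simp
  then have 2: "card (?V - (?A \<union> ?B)) \<le> card (pjoin n x y)"
    using card_collapse_ge[of n "?A \<union> ?B"] by linarith
  have "refines ?V c (collapse n ((?V - ?A) \<union> ?B))"
    unfolding c_def by (rule refines_collapse_mono) auto
  then have "refines ?V (pjoin n c y) (collapse n ((?V - ?A) \<union> ?B))"
    by (rule pjoin(3)[OF c y _ refines_collapse[OF y]]) auto
  then have "card (collapse n ((?V - ?A) \<union> ?B)) \<le> card (pjoin n c y)" by (rule refines_card_le[rotated]) simp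
  then have 3: "card (?V - ((?V - ?A) \<union> ?B)) \<le> card (pjoin n c y)"
    using card_collapse_ge[of n "(?V - ?A) \<union> ?B"] by linarith
  have "card (?V - ?B) \<le> card ((?V - (?A \<union> ?B)) \<union> (?V - ((?V - ?A) \<union> ?B)))"
    by (rule card_mono) auto
  also have "\<dots> \<le> card (?V - (?A \<union> ?B)) + card (?V - ((?V - ?A) \<union> ?B))" by (rule card_Un_le)
  finally show ?thesis using 1 2 3 by linarith
qed

end

section \<open>Evaluation of formulas\<close>

text \<open>The part of being a structure that is needed for suprema and infima of formulas to exist.  It is
  stated separately because for partition lattices it can be checked without discussing completeness.\<close>
definition bounded_structure :: "'a lstruct \<Rightarrow> bool" where
  "bounded_structure M \<longleftrightarrow> lzero M \<in> carrier M \<and> lone M \<in> carrier M \<and>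
     (\<forall>x\<in>carrier M. \<forall>y\<in>carrier M. ladd M x y \<in> carrier M \<and> ldist M x y \<in> {0..1})"

lemma eval_tm_closed:
  assumes "bounded_structure M" "\<And>i. e i \<in> carrier M"
  shows "eval_tm M t e \<in> carrier M"
  using assms by (induction t) (auto simp: bounded_structure_def)

lemma tuple_in_cube: "set rs \<subseteq> {0..1} \<Longrightarrow> tuple rs \<in> {..<length rs} \<rightarrow>\<^sub>E {0..1}"
  unfolding tuple_def by (auto simp: subset_iff)

lemma tuple_nth: "i < length rs \<Longrightarrow> tuple rs i = rs ! i"
  by (simp add: tuple_def)

lemma eval_bounds:
  assumes M: "bounded_structure M"
  shows "is_formula \<phi> \<Longrightarrow> (\<And>i. e i \<in> carrier M) \<Longrightarrow> eval M \<phi> e \<in> {0..1}"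
proof (induction \<phi> arbitrary: e)
  case (Dist s t)
  then show ?case using eval_tm_closed[OF M, of e] M by (auto simp: bounded_structure_def)
next
  case (Conn u \<phi>s)
  have "tuple (map (\<lambda>\<phi>. eval M \<phi> e) \<phi>s) \<in> {..<length (map (\<lambda>\<phi>. eval M \<phi> e) \<phi>s)} \<rightarrow>\<^sub>E {0..1}"
  proof (rule tuple_in_cube)
    show "set (map (\<lambda>\<phi>. eval M \<phi> e) \<phi>s) \<subseteq> {0..1}"
      using Conn.IH Conn.prems by fastforce
  qed
  then show ?case using Conn.prems(1) by (simp add: connective_def Pi_iff)
next
  case (SupQ i \<phi>)
  have *: "eval M \<phi> (e(i := a)) \<in> {0..1}" if "a \<in> carrier M" for a
    using SupQ.prems that by (intro SupQ.IH) auto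
  have ne: "lzero M \<in> carrier M" using M by (simp add: bounded_structure_def)
  have "bdd_above ((\<lambda>a. eval M \<phi> (e(i := a))) ` carrier M)"
    by (rule bdd_aboveI[of _ 1]) (use * in auto)
  then have "eval M \<phi> (e(i := lzero M)) \<le> (SUP a\<in>carrier M. eval M \<phi> (e(i := a)))"
    using ne by (rule cSUP_upper[rotated])
  moreover have "(SUP a\<in>carrier M. eval M \<phi> (e(i := a))) \<le> 1"
    by (rule cSUP_least) (use * ne in auto)
  ultimately show ?case using *[OF ne] by simp
next
  case (InfQ i \<phi>)
  have *: "eval M \<phi> (e(i := a)) \<in> {0..1}" if "a \<in> carrier M" for a
    using InfQ.prems that by (intro InfQ.IH) auto
  have ne: "lzero M \<in> carrier M" using M by (simp add: bounded_structure_def)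
  have "bdd_below ((\<lambda>a. eval M \<phi> (e(i := a))) ` carrier M)"
    by (rule bdd_belowI[of _ 0]) (use * in auto)
  then have "(INF a\<in>carrier M. eval M \<phi> (e(i := a))) \<le> eval M \<phi> (e(i := lzero M))"
    using ne by (rule cINF_lower)
  moreover have "0 \<le> (INF a\<in>carrier M. eval M \<phi> (e(i := a)))"
    by (rule cINF_greatest) (use * ne in auto)
  ultimately show ?case using *[OF ne] by simp
qed

context
  fixes M :: "'a lstruct" and \<phi> :: fm and e :: "nat \<Rightarrow> 'a"
  assumes M: "bounded_structure M" and \<phi>: "is_formula \<phi>" and e: "\<And>i. e i \<in> carrier M"
begin

lemma eval_upd_bounds: "a \<in> carrier M \<Longrightarrow> eval M \<phi> (e(i := a)) \<in> {0..1}"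
  using e by (intro eval_bounds[OF M \<phi>]) auto

lemma carrier_nonempty: "carrier M \<noteq> {}"
  using M by (auto simp: bounded_structure_def)

lemma eval_SupQ_upper:
  assumes "a \<in> carrier M"
  shows "eval M \<phi> (e(i := a)) \<le> eval M (SupQ i \<phi>) e"
proof -
  have "bdd_above ((\<lambda>a. eval M \<phi> (e(i := a))) ` carrier M)"
    by (rule bdd_aboveI[of _ 1]) (use eval_upd_bounds in auto)
  then show ?thesis using cSUP_upper[OF assms, of "\<lambda>a. eval M \<phi> (e(i := a))"] by simp
qed

lemma eval_SupQ_least:
  assumes "\<And>a. a \<in> carrier M \<Longrightarrow> eval M \<phi> (e(i := a)) \<le> c"
  shows "eval M (SupQ i \<phi>) e \<le> c"
  using assms carrier_nonempty by (simp add: cSUP_least)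

lemma eval_InfQ_lower:
  assumes "a \<in> carrier M"
  shows "eval M (InfQ i \<phi>) e \<le> eval M \<phi> (e(i := a))"
proof -
  have "bdd_below ((\<lambda>a. eval M \<phi> (e(i := a))) ` carrier M)"
    by (rule bdd_belowI[of _ 0]) (use eval_upd_bounds in auto)
  then show ?thesis using cINF_lower[OF _ assms, of "\<lambda>a. eval M \<phi> (e(i := a))"] by simp
qed

lemma eval_InfQ_lessE:
  assumes "eval M (InfQ i \<phi>) e < c"
  obtains a where "a \<in> carrier M" "eval M \<phi> (e(i := a)) < c"
proof -
  have "bdd_below ((\<lambda>a. eval M \<phi> (e(i := a))) ` carrier M)"
    by (rule bdd_belowI[of _ 0]) (use eval_upd_bounds in auto)
  then show ?thesis using assms that carrier_nonempty by (auto simp: cINF_less_iff)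
qed

end

lemma eval_tm_cong: "(\<And>i. i \<in> fv_tm t \<Longrightarrow> e i = e' i) \<Longrightarrow> eval_tm M t e = eval_tm M t e'"
  by (induction t) auto

lemma eval_cong: "(\<And>i. i \<in> fv \<phi> \<Longrightarrow> e i = e' i) \<Longrightarrow> eval M \<phi> e = eval M \<phi> e'"
proof (induction \<phi> arbitrary: e e')
  case (Dist s t)
  then show ?case using eval_tm_cong[of s e e' M] eval_tm_cong[of t e e' M] by auto
next
  case (Conn u \<phi>s)
  have "map (\<lambda>\<phi>. eval M \<phi> e) \<phi>s = map (\<lambda>\<phi>. eval M \<phi> e') \<phi>s"
  proof (rule map_cong[OF refl])
    fix \<phi> assume \<phi>: "\<phi> \<in> set \<phi>s"
    show "eval M \<phi> e = eval M \<phi> e'"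
      using Conn.prems \<phi> by (intro Conn.IH[OF \<phi>]) auto
  qed
  then show ?case by (simp only: eval.simps)
next
  case (SupQ i \<phi>)
  have "eval M \<phi> (e(i := a)) = eval M \<phi> (e'(i := a))" for a
    using SupQ.prems by (intro SupQ.IH) auto
  then show ?case by simp
next
  case (InfQ i \<phi>)
  have "eval M \<phi> (e(i := a)) = eval M \<phi> (e'(i := a))" for a
    using InfQ.prems by (intro InfQ.IH) auto
  then show ?case by simp
qed

lemma finite_fv_tm: "finite (fv_tm t)"
  by (induction t) auto

lemma finite_fv: "finite (fv \<phi>)"
  by (induction \<phi>) (auto simp: finite_fv_tm)

lemma is_formula_closure: "is_formula (foldr SupQ vs \<phi>) \<longleftrightarrow> is_formula \<phi>"
  by (induction vs) auto

lemma fv_closure: "fv (foldr SupQ vs \<phi>) = fv \<phi> - set vs"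
  by (induction vs) auto

lemma eval_SupQ_zero_iff:
  assumes "bounded_structure M" "is_formula \<phi>"
  shows "(\<forall>e. (\<forall>i. e i \<in> carrier M) \<longrightarrow> eval M (SupQ i \<phi>) e = 0) \<longleftrightarrow>
    (\<forall>e. (\<forall>i. e i \<in> carrier M) \<longrightarrow> eval M \<phi> e = 0)"
proof (intro iffI allI impI)
  fix e :: "nat \<Rightarrow> 'a" assume e: "\<forall>i. e i \<in> carrier M"
  assume "\<forall>e. (\<forall>i. e i \<in> carrier M) \<longrightarrow> eval M (SupQ i \<phi>) e = 0"
  then have "eval M \<phi> (e(i := e i)) \<le> 0"
    using eval_SupQ_upper[OF assms, of e "e i" i] e by simp
  then show "eval M \<phi> e = 0" using eval_bounds[OF assms, of e] e by simp
next
  fix e :: "nat \<Rightarrow> 'a" assume e: "\<forall>i. e i \<in> carrier M"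
  assume "\<forall>e. (\<forall>i. e i \<in> carrier M) \<longrightarrow> eval M \<phi> e = 0"
  then have "eval M (SupQ i \<phi>) e \<le> 0"
    using e by (intro eval_SupQ_least[OF assms]) auto
  moreover have "0 \<le> eval M (SupQ i \<phi>) e"
    using eval_bounds[OF assms(1), of "SupQ i \<phi>" e] e assms(2) by simp
  ultimately show "eval M (SupQ i \<phi>) e = 0" by simp
qed

lemma eval_closure_zero_iff:
  assumes "bounded_structure M" "is_formula \<phi>"
  shows "(\<forall>e. (\<forall>i. e i \<in> carrier M) \<longrightarrow> eval M (foldr SupQ vs \<phi>) e = 0) \<longleftrightarrow>
    (\<forall>e. (\<forall>i. e i \<in> carrier M) \<longrightarrow> eval M \<phi> e = 0)"
proof (induction vs)
  case (Cons i vs)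
  then show ?case
    using eval_SupQ_zero_iff[OF assms(1), of "foldr SupQ vs \<phi>" i] assms(2)
    by (simp only: foldr.simps o_apply is_formula_closure)
qed simp

section \<open>Transfer from partition lattices to models\<close>

lemma is_lstruct_bounded:
  assumes "is_lstruct M"
  shows "bounded_structure M"
proof -
  have "0 \<le> ldist M x y" if "x \<in> carrier M" "y \<in> carrier M" for x y
    using assms that Metric_space.nonneg[of "carrier M" "ldist_on M" x y]
    by (auto simp: is_lstruct_def ldist_on_def)
  then show ?thesis using assms by (auto simp: is_lstruct_def bounded_structure_def)
qed

text \<open>The universal closure of \<open>\<phi>\<close> is a sentence that vanishes in all partition lattices.\<close>
lemma theory_transfer:
  assumes M: "M \<Turnstile> T_FPL" and P: "\<And>n. n \<ge> 2 \<Longrightarrow> bounded_structure (partition_lattice n)"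
    and \<phi>: "is_formula \<phi>"
    and zero: "\<And>n e. n \<ge> 2 \<Longrightarrow> (\<And>i. e i \<in> carrier (partition_lattice n)) \<Longrightarrow>
      eval (partition_lattice n) \<phi> e = 0"
    and e: "\<And>i. e i \<in> carrier M"
  shows "eval M \<phi> e = 0"
proof -
  obtain vs where vs: "set vs = fv \<phi>" using finite_list[OF finite_fv] by blast
  let ?\<sigma> = "foldr SupQ vs \<phi>"
  have fv: "fv ?\<sigma> = {}" by (simp add: fv_closure vs)
  have "sval (partition_lattice n) ?\<sigma> = 0" if n: "n \<ge> 2" for n
  proof -
    have "\<forall>e. (\<forall>i. e i \<in> carrier (partition_lattice n)) \<longrightarrow> eval (partition_lattice n) ?\<sigma> e = 0"
      using eval_closure_zero_iff[OF P[OF n] \<phi>] zero[OF n] by blast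
    moreover have "lzero (partition_lattice n) \<in> carrier (partition_lattice n)"
      using P[OF n] by (simp add: bounded_structure_def)
    ultimately show ?thesis by (simp add: sval_def)
  qed
  then have "?\<sigma> \<in> T_FPL" using \<phi> fv by (simp add: T_FPL_def sentence_def is_formula_closure)
  then have "sval M ?\<sigma> = 0" using M by (simp add: models_def)
  then have "eval M ?\<sigma> e = 0" for e
    using eval_cong[of ?\<sigma> e "\<lambda>_. lzero M" M] fv by (simp add: sval_def)
  moreover have "bounded_structure M" using M is_lstruct_bounded by (auto simp: models_def)
  ultimately show ?thesis using eval_closure_zero_iff[OF _ \<phi>, of M vs] e by blast
qed

text \<open>An infinite model does not see the small partition lattices.  Multiply \<open>\<phi>\<close> by the pairwise distances of \<open>K\<close> new
  variables.  In a partition lattice with fewer than \<open>K\<close> elements two of the new variables coincide and the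
  product vanishes; in an infinite model they can be given distinct values, and then \<open>\<phi>\<close> itself
  has to vanish.\<close>
lemma theory_transfer_large:
  assumes M: "M \<Turnstile> T_FPL" and P: "\<And>n. n \<ge> 2 \<Longrightarrow> bounded_structure (partition_lattice n)"
    and refl: "\<And>n x. n \<ge> 2 \<Longrightarrow> x \<in> carrier (partition_lattice n) \<Longrightarrow> ldist (partition_lattice n) x x = 0"
    and inf: "infinite (carrier M)"
    and \<phi>: "is_formula \<phi>"
    and zero: "\<And>n e. n \<ge> N \<Longrightarrow> n \<ge> 2 \<Longrightarrow> (\<And>i. e i \<in> carrier (partition_lattice n)) \<Longrightarrow>
      eval (partition_lattice n) \<phi> e = 0"
    and e: "\<And>i. e i \<in> carrier M"
  shows "eval M \<phi> e = 0"
proof -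
  define K where "K = Suc (\<Sum>n<N. card (carrier (partition_lattice n)))"
  have fin: "finite (carrier (partition_lattice n))" for n
    by (simp add: partition_lattice_def partition_order_def finitely_many_partition_on)
  have K: "card (carrier (partition_lattice n)) < K" if "n < N" for n
    using member_le_sum[of n "{..<N}" "\<lambda>n. card (carrier (partition_lattice n))"] that
    by (simp add: K_def)
  obtain m where m: "\<And>i. i \<in> fv \<phi> \<Longrightarrow> i < m"
    using finite_fv[of \<phi>] by (metis finite_nat_set_iff_bounded)
  define ps where "ps = concat (map (\<lambda>i. map (\<lambda>j. (i, j)) [0..<i]) [0..<K])"
  have ps: "set ps = {(i, j). j < i \<and> i < K}" by (auto simp: ps_def)
  define \<psi>s where "\<psi>s = \<phi> # map (\<lambda>(i, j). Dist (Var (m + i)) (Var (m + j))) ps"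
  define \<psi> where "\<psi> = Conn (\<lambda>r. \<Prod>i<length \<psi>s. r i) \<psi>s"
  have "connective (length \<psi>s) (\<lambda>r. \<Prod>i<length \<psi>s. r i)"
    unfolding connective_def
  proof
    show "continuous_on ({..<length \<psi>s} \<rightarrow>\<^sub>E {0..1}) (\<lambda>r. \<Prod>i<length \<psi>s. r i :: real)"
      by (intro continuous_on_prod continuous_on_subset[OF continuous_on_product_coordinates]) simp
    show "(\<lambda>r. \<Prod>i<length \<psi>s. r i :: real) \<in> ({..<length \<psi>s} \<rightarrow>\<^sub>E {0..1}) \<rightarrow> {0..1}"
    proof
      fix r :: "nat \<Rightarrow> real" assume "r \<in> {..<length \<psi>s} \<rightarrow>\<^sub>E {0..1}"
      then have "\<forall>i\<in>{..<length \<psi>s}. 0 \<le> r i \<and> r i \<le> 1" by (simp add: PiE_iff)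
      then show "(\<Prod>i<length \<psi>s. r i) \<in> {0..1}"
        using prod_nonneg[of "{..<length \<psi>s}" r] prod_le_1[of "{..<length \<psi>s}" r] by simp
    qed
  qed
  then have \<psi>: "is_formula \<psi>" using \<phi> by (auto simp: \<psi>_def \<psi>s_def)
  have eval_\<psi>: "eval N' \<psi> e' = 0 \<longleftrightarrow> eval N' \<phi> e' = 0 \<or>
      (\<exists>i j. j < i \<and> i < K \<and> ldist N' (e' (m + i)) (e' (m + j)) = 0)" for N' :: "'b lstruct" and e'
  proof -
    have "eval N' \<psi> e' = 0 \<longleftrightarrow> (\<exists>i<length \<psi>s. eval N' (\<psi>s ! i) e' = 0)"
      by (simp add: \<psi>_def tuple_nth Bex_def)
    also have "\<dots> \<longleftrightarrow> (\<exists>\<phi>\<in>set \<psi>s. eval N' \<phi> e' = 0)" by (metis in_set_conv_nth)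
    also have "\<dots> \<longleftrightarrow> eval N' \<phi> e' = 0 \<or>
        (\<exists>i j. j < i \<and> i < K \<and> ldist N' (e' (m + i)) (e' (m + j)) = 0)"
      by (auto simp: \<psi>s_def ps)
    finally show ?thesis .
  qed
  have zero': "eval (partition_lattice n) \<psi> e' = 0"
    if n: "n \<ge> 2" and e': "\<And>i. e' i \<in> carrier (partition_lattice n)" for n e'
  proof (cases "n \<ge> N")
    case True
    then have "eval (partition_lattice n) \<phi> e' = 0" by (rule zero[OF _ n e'])
    then show ?thesis using eval_\<psi>[of "partition_lattice n" e'] by simp
  next
    case False
    have "\<not> inj_on (\<lambda>i. e' (m + i)) {..<K}"
    proof
      assume "inj_on (\<lambda>i. e' (m + i)) {..<K}"
      then have "K \<le> card (carrier (partition_lattice n))"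
        using card_inj_on_le[of "\<lambda>i. e' (m + i)" "{..<K}"] e' fin by auto
      then show False using K[of n] False by simp
    qed
    then obtain i j where ij: "i < K" "j < K" "i \<noteq> j" "e' (m + i) = e' (m + j)"
      by (auto simp: inj_on_def)
    have "ldist (partition_lattice n) (e' (m + max i j)) (e' (m + min i j)) = 0"
      using refl[OF n e'] ij(4) by (simp add: max_def min_def)
    moreover have "min i j < max i j" "max i j < K" using ij by auto
    ultimately show ?thesis using eval_\<psi>[of "partition_lattice n" e'] by blast
  qed
  obtain B where B: "B \<subseteq> carrier M" "finite B" "card B = K"
    using infinite_arbitrarily_large[OF inf] by blast
  obtain b where b: "bij_betw b {..<K} B"
    using B bij_betw_from_nat_into_finite by metis
  define e' where "e' = (\<lambda>i. if i < m then e i else if i - m < K then b (i - m) else lzero M)"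
  have str: "is_lstruct M" using M by (simp add: models_def)
  have "e' i \<in> carrier M" for i
    using e bij_betwE[OF b] B(1) str by (auto simp: e'_def is_lstruct_def)
  then have "eval M \<psi> e' = 0" by (intro theory_transfer[OF M P \<psi> zero']) auto
  moreover have "ldist M (e' (m + i)) (e' (m + j)) \<noteq> 0" if "j < i" "i < K" for i j
  proof -
    have "b i \<noteq> b j" using bij_betw_imp_inj_on[OF b] that by (auto dest: inj_onD)
    moreover have "b i \<in> carrier M" "b j \<in> carrier M" using bij_betwE[OF b] B(1) that by auto
    ultimately show ?thesis
      using that str Metric_space.zero[of "carrier M" "ldist_on M" "b i" "b j"]
      by (auto simp: e'_def is_lstruct_def ldist_on_def)
  qed
  ultimately have "eval M \<phi> e' = 0" using eval_\<psi>[of M e'] by blast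
  then show ?thesis using eval_cong[of \<phi> e e' M] m by (simp add: e'_def)
qed

text \<open>Truncating a continuous function of truth values to \<open>[0, 1]\<close> yields a connective that vanishes exactly
  where the function is at most \<open>0\<close>.  In this way arbitrary closed conditions on truth values are expressed
  by formulas.\<close>
definition clip :: "real \<Rightarrow> real" where
  "clip t = max 0 (min 1 t)"

lemma clip_le: "t \<le> c \<Longrightarrow> 0 \<le> c \<Longrightarrow> clip t \<le> c"
  by (auto simp: clip_def)

lemma clip_lessD: "clip t < c \<Longrightarrow> c \<le> 1 \<Longrightarrow> t < c"
  by (auto simp: clip_def)

lemma clip_eq_0_iff: "clip t = 0 \<longleftrightarrow> t \<le> 0"
  by (auto simp: clip_def)

definition clip_conn :: "((nat \<Rightarrow> real) \<Rightarrow> real) \<Rightarrow> fm list \<Rightarrow> fm" where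
  "clip_conn g \<phi>s = Conn (\<lambda>r. clip (g r)) \<phi>s"

lemma is_formula_clip_conn:
  assumes "continuous_on UNIV g" "\<And>\<phi>. \<phi> \<in> set \<phi>s \<Longrightarrow> is_formula \<phi>"
  shows "is_formula (clip_conn g \<phi>s)"
proof -
  have "continuous_on UNIV (\<lambda>r. clip (g r))"
    unfolding clip_def using assms(1) by (intro continuous_intros)
  then have "connective (length \<phi>s) (\<lambda>r. clip (g r))"
    unfolding connective_def by (auto intro: continuous_on_subset simp: clip_def)
  then show ?thesis using assms(2) by (simp add: clip_conn_def)
qed

lemma eval_clip_conn: "eval M (clip_conn g \<phi>s) e = clip (g (tuple (map (\<lambda>\<phi>. eval M \<phi> e) \<phi>s)))"
  by (simp add: clip_conn_def)

section \<open>Approximate modularity\<close>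

text \<open>The element \<open>z\<close> plays the role of the meet of \<open>x\<close> and \<open>y\<close>, but it is a lower bound only up to \<open>\<epsilon>\<close>.\<close>
definition approx_modular :: "'a lstruct \<Rightarrow> real \<Rightarrow> 'a \<Rightarrow> bool" where
  "approx_modular M \<epsilon> x \<longleftrightarrow> (\<forall>y\<in>carrier M. \<exists>z\<in>carrier M.
     lnorm M x + lnorm M y - lnorm M (ladd M x y) - lnorm M z \<le> \<epsilon> \<and>
     ldist M (ladd M z x) x \<le> \<epsilon> \<and> ldist M (ladd M z y) y \<le> \<epsilon>)"

text \<open>The value of this formula is the infimum of all \<open>\<epsilon>\<close> for which the variable \<open>i\<close> is approximately
  modular, truncated to \<open>[0, 1]\<close>.  The bound variables \<open>3\<close> and
  \<open>4\<close> leave \<open>0\<close>, \<open>1\<close> and \<open>2\<close> for the arguments.\<close>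
definition modular_defect :: "nat \<Rightarrow> fm" where
  "modular_defect i = SupQ 3 (InfQ 4 (clip_conn
     (\<lambda>r. max (r 0 + r 1 - r 2 - r 3) (max (r 4) (r 5)))
     [Dist (Var i) Zero, Dist (Var 3) Zero, Dist (Add (Var i) (Var 3)) Zero, Dist (Var 4) Zero,
      Dist (Add (Var 4) (Var i)) (Var i), Dist (Add (Var 4) (Var 3)) (Var 3)]))"

lemma is_formula_modular_defect: "is_formula (modular_defect i)"
  unfolding modular_defect_def is_formula.simps
  by (rule is_formula_clip_conn) (auto intro!: continuous_intros)

context
  fixes M :: "'a lstruct" and e :: "nat \<Rightarrow> 'a" and i :: nat
  assumes M: "bounded_structure M" and e: "\<And>i. e i \<in> carrier M" and i: "i < 3"
begin

text \<open>The infimum over \<open>z\<close> need not be attained, hence the strict inequality.  The restriction \<open>\<epsilon> \<le> 1\<close> comes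
  from the truncation to \<open>[0, 1]\<close>.\<close>
lemma modular_defect_less_imp:
  assumes "eval M (modular_defect i) e < \<epsilon>" "\<epsilon> \<le> 1"
  shows "approx_modular M \<epsilon> (e i)"
  unfolding approx_modular_def
proof
  fix y assume y: "y \<in> carrier M"
  note f = is_formula_modular_defect[of i, unfolded modular_defect_def is_formula.simps]
  have f': "is_formula (InfQ j \<phi>)" if "is_formula \<phi>" for j \<phi> using that by simp
  have e': "(e(3 := y)) j \<in> carrier M" for j using e y by simp
  note less = le_less_trans[OF eval_SupQ_upper[OF M f'[where j = 4, OF f] e y, where i = 3] assms(1)[unfolded modular_defect_def]]
  obtain z where z: "z \<in> carrier M" "eval M (clip_conn
     (\<lambda>r. max (r 0 + r 1 - r 2 - r 3) (max (r 4) (r 5)))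
     [Dist (Var i) Zero, Dist (Var 3) Zero, Dist (Add (Var i) (Var 3)) Zero, Dist (Var 4) Zero,
      Dist (Add (Var 4) (Var i)) (Var i), Dist (Add (Var 4) (Var 3)) (Var 3)]) ((e(3 := y))(4 := z)) < \<epsilon>"
    by (rule eval_InfQ_lessE[OF M f e' less])
  show "\<exists>z\<in>carrier M. lnorm M (e i) + lnorm M y - lnorm M (ladd M (e i) y) - lnorm M z \<le> \<epsilon> \<and>
     ldist M (ladd M z (e i)) (e i) \<le> \<epsilon> \<and> ldist M (ladd M z y) y \<le> \<epsilon>"
    using z(1) clip_lessD[OF z(2)[unfolded eval_clip_conn] assms(2)] i
    by (intro bexI[of _ z]) (auto simp: tuple_nth lnorm_def)
qed

lemma approx_modular_imp_le:
  assumes am: "approx_modular M \<epsilon> (e i)" and eps: "0 \<le> \<epsilon>"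
  shows "eval M (modular_defect i) e \<le> \<epsilon>"
  unfolding modular_defect_def
proof (rule eval_SupQ_least[OF M _ e])
  note f = is_formula_modular_defect[of i, unfolded modular_defect_def is_formula.simps]
  then show "is_formula (InfQ 4 (clip_conn
     (\<lambda>r. max (r 0 + r 1 - r 2 - r 3) (max (r 4) (r 5)))
     [Dist (Var i) Zero, Dist (Var 3) Zero, Dist (Add (Var i) (Var 3)) Zero, Dist (Var 4) Zero,
      Dist (Add (Var 4) (Var i)) (Var i), Dist (Add (Var 4) (Var 3)) (Var 3)]))" by simp
  fix y assume y: "y \<in> carrier M"
  have e': "(e(3 := y)) j \<in> carrier M" for j using e y by simp
  obtain z where z: "z \<in> carrier M"
    "lnorm M (e i) + lnorm M y - lnorm M (ladd M (e i) y) - lnorm M z \<le> \<epsilon>"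
    "ldist M (ladd M z (e i)) (e i) \<le> \<epsilon>" "ldist M (ladd M z y) y \<le> \<epsilon>"
    using am y unfolding approx_modular_def by blast
  show "eval M (InfQ 4 (clip_conn
     (\<lambda>r. max (r 0 + r 1 - r 2 - r 3) (max (r 4) (r 5)))
     [Dist (Var i) Zero, Dist (Var 3) Zero, Dist (Add (Var i) (Var 3)) Zero, Dist (Var 4) Zero,
      Dist (Add (Var 4) (Var i)) (Var i), Dist (Add (Var 4) (Var 3)) (Var 3)])) (e(3 := y)) \<le> \<epsilon>"
    by (rule order_trans[OF eval_InfQ_lower[OF M f e' z(1)]], subst eval_clip_conn, rule clip_le[OF _ eps])
      (use z i in \<open>auto simp: tuple_nth lnorm_def\<close>)
qed

end

section \<open>Partition lattices as metric structures\<close>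

lemma partition_lattice_simps:
  "carrier (partition_lattice n) = {x. partition_on {1..n} x}"
  "ladd (partition_lattice n) x y = pjoin n x y"
  "lzero (partition_lattice n) = \<bottom>\<^bsub>partition_order n\<^esub>"
  "lone (partition_lattice n) = \<top>\<^bsub>partition_order n\<^esub>"
  "ldist (partition_lattice n) x y =
    (real (card x) + real (card y) - 2 * real (card (pjoin n x y))) / (real n - 1)"
  by (simp_all add: partition_lattice_def partition_order_def)

lemma pjoin_idem: "partition_on {1..n} x \<Longrightarrow> pjoin n x x = x"
  by (rule refines_imp_pjoin[OF refines_refl])

lemma card_pjoin_le:
  assumes "partition_on {1..n} x" "partition_on {1..n} y"
  shows "card (pjoin n x y) \<le> card x" "card (pjoin n x y) \<le> card y"
  using refines_card_le[OF _ pjoin(1)[OF assms]] refines_card_le[OF _ pjoin(2)[OF assms]] by simp_all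

lemma partition_on_bottom: "partition_on {1..n} (\<bottom>\<^bsub>partition_order n\<^esub>)"
  unfolding partition_bottom by (rule partition_on_kernel)

lemma partition_on_top: "partition_on {1..n} (\<top>\<^bsub>partition_order n\<^esub>)"
  unfolding partition_top by (rule partition_on_kernel)

lemma card_partition_ge: "n \<ge> 1 \<Longrightarrow> partition_on {1..n::nat} x \<Longrightarrow> card x \<ge> 1"
  using refines_card_le[OF _ refines_top[of n x]] card_partition_top[of n] by simp

lemma pjoin_bottom: "partition_on {1..n} x \<Longrightarrow> pjoin n x (\<bottom>\<^bsub>partition_order n\<^esub>) = x"
  using refines_imp_pjoin[OF refines_bottom] pjoin_comm[OF _ partition_on_bottom] by simp

lemma lnorm_partition_lattice:
  assumes "partition_on {1..n} x"
  shows "lnorm (partition_lattice n) x = (real n - real (card x)) / (real n - 1)"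
  using pjoin_bottom[OF assms] by (simp add: lnorm_def partition_lattice_simps card_partition_bottom)

lemma ldist_partition_lattice_join:
  assumes "partition_on {1..n} x" "partition_on {1..n} y"
  shows "ldist (partition_lattice n) (pjoin n x y) y =
    (real (card y) - real (card (pjoin n x y))) / (real n - 1)"
proof -
  have "pjoin n (pjoin n x y) y = pjoin n x y"
    using pjoin_assoc[OF assms(1,2,2)] pjoin_idem[OF assms(2)] by simp
  then show ?thesis by (simp add: partition_lattice_simps)
qed

lemma ldist_partition_lattice_self:
  "x \<in> carrier (partition_lattice n) \<Longrightarrow> ldist (partition_lattice n) x x = 0"
  by (simp add: partition_lattice_simps pjoin_idem)

lemma bounded_structure_partition_lattice:
  assumes n: "n \<ge> 2"
  shows "bounded_structure (partition_lattice n)"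
proof -
  have "ldist (partition_lattice n) x y \<in> {0..1}"
    if x: "partition_on {1..n} x" and y: "partition_on {1..n} y" for x y
  proof -
    have "card x + card y \<le> card (pjoin n x y) + n"
      using card_semimodular[OF refines_bottom[OF x] refines_bottom[OF y]] card_partition_bottom by simp
    moreover have "1 \<le> card (pjoin n x y)"
      using n by (intro card_partition_ge[of n] partition_on_pjoin x y) simp
    ultimately show ?thesis
      using card_pjoin_le[OF x y] n by (simp add: partition_lattice_simps divide_simps)
  qed
  then show ?thesis
    using partition_on_pjoin partition_on_bottom partition_on_top
    by (auto simp: bounded_structure_def partition_lattice_simps)
qed

lemma approx_modular_partition_lattice_iff:
  assumes n: "n \<ge> 2" and x: "partition_on {1..n} x"
  shows "approx_modular (partition_lattice n) \<epsilon> x \<longleftrightarrow>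
    (\<forall>y. partition_on {1..n} y \<longrightarrow> (\<exists>z. partition_on {1..n} z \<and>
      real (card (pjoin n x y)) + real (card z) \<le> real (card x) + real (card y) + \<epsilon> * (real n - 1) \<and>
      real (card x) \<le> real (card (pjoin n z x)) + \<epsilon> * (real n - 1) \<and>
      real (card y) \<le> real (card (pjoin n z y)) + \<epsilon> * (real n - 1)))"
proof -
  have pos: "0 < real n - 1" using n by simp
  have 1: "lnorm (partition_lattice n) x + lnorm (partition_lattice n) y
      - lnorm (partition_lattice n) (pjoin n x y) - lnorm (partition_lattice n) z \<le> \<epsilon> \<longleftrightarrow>
    real (card (pjoin n x y)) + real (card z) \<le> real (card x) + real (card y) + \<epsilon> * (real n - 1)"
    if y: "partition_on {1..n} y" and z: "partition_on {1..n} z" for y z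
    unfolding lnorm_partition_lattice[OF x] lnorm_partition_lattice[OF y] lnorm_partition_lattice[OF z]
      lnorm_partition_lattice[OF partition_on_pjoin[OF x y]] add_divide_distrib[symmetric]
      diff_divide_distrib[symmetric] pos_divide_le_eq[OF pos] by auto
  have 2: "ldist (partition_lattice n) (pjoin n z y) y \<le> \<epsilon> \<longleftrightarrow>
    real (card y) \<le> real (card (pjoin n z y)) + \<epsilon> * (real n - 1)"
    if y: "partition_on {1..n} y" and z: "partition_on {1..n} z" for y z
    unfolding ldist_partition_lattice_join[OF z y] pos_divide_le_eq[OF pos] by auto
  show ?thesis
    unfolding approx_modular_def partition_lattice_simps(1,2) using 1 2 2[OF x]
    by (simp add: Ball_def Bex_def cong: conj_cong)
qed

text \<open>The last inequality says that \<open>x'\<close> splits every modular \<open>y\<close>: for exactly modular elements of norm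
  sum \<open>1\<close> it amounts to \<open>|y| \<le> |xy| + |x'y|\<close>.  Besides, it makes \<open>x'\<close> unique up to a small
  error, which is what turns approximate complements into convergent sequences.\<close>
definition complement_property :: "'a lstruct \<Rightarrow> real \<Rightarrow> real \<Rightarrow> bool" where
  "complement_property M \<epsilon> \<delta> \<longleftrightarrow> (\<forall>x\<in>carrier M. approx_modular M \<delta> x \<longrightarrow>
     (\<exists>x'\<in>carrier M. approx_modular M \<epsilon> x' \<and> lnorm M (ladd M x x') \<ge> 1 - \<epsilon> \<and>
        lnorm M x + lnorm M x' \<le> 1 + \<epsilon> \<and>
        (\<forall>y\<in>carrier M. approx_modular M \<delta> y \<longrightarrow>
           lnorm M (ladd M x y) + lnorm M (ladd M x' y) \<le> 1 + lnorm M y + \<epsilon>)))"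

lemma approx_modular_mono: "approx_modular M \<epsilon> x \<Longrightarrow> \<epsilon> \<le> \<epsilon>' \<Longrightarrow> approx_modular M \<epsilon>' x"
  unfolding approx_modular_def by (meson order_trans)

lemma complement_property_mono:
  assumes "complement_property M \<epsilon> \<delta>" "\<epsilon> \<le> \<epsilon>'"
  shows "complement_property M \<epsilon>' \<delta>"
  unfolding complement_property_def
proof (intro ballI impI)
  fix x assume "x \<in> carrier M" "approx_modular M \<delta> x"
  then obtain x' where x': "x' \<in> carrier M" "approx_modular M \<epsilon> x'"
    "lnorm M (ladd M x x') \<ge> 1 - \<epsilon>" "lnorm M x + lnorm M x' \<le> 1 + \<epsilon>"
    "\<And>y. y \<in> carrier M \<Longrightarrow> approx_modular M \<delta> y \<Longrightarrow>
       lnorm M (ladd M x y) + lnorm M (ladd M x' y) \<le> 1 + lnorm M y + \<epsilon>"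
    using assms(1) unfolding complement_property_def by blast
  show "\<exists>x'\<in>carrier M. approx_modular M \<epsilon>' x' \<and> lnorm M (ladd M x x') \<ge> 1 - \<epsilon>' \<and>
        lnorm M x + lnorm M x' \<le> 1 + \<epsilon>' \<and>
        (\<forall>y\<in>carrier M. approx_modular M \<delta> y \<longrightarrow>
           lnorm M (ladd M x y) + lnorm M (ladd M x' y) \<le> 1 + lnorm M y + \<epsilon>')"
  proof (intro bexI[OF _ x'(1)] conjI ballI impI)
    show "approx_modular M \<epsilon>' x'" by (rule approx_modular_mono[OF x'(2) assms(2)])
  qed (use x'(3,4) x'(5) assms(2) in fastforce)+
qed

text \<open>With \<open>D = \<epsilon> / 28 * (n - 1)\<close> the number of nontrivial blocks is at most \<open>14 * D + 1\<close>, which is half of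
  \<open>\<epsilon> * (n - 1)\<close> plus \<open>1\<close>.  The other half absorbs the additive constants, which are at most \<open>2\<close>;
  this is where \<open>4 \<le> \<epsilon> * (n - 1)\<close> is used.\<close>
lemma complement_property_partition_lattice:
  assumes n: "n \<ge> 2" and \<epsilon>: "4 \<le> \<epsilon> * (real n - 1)"
  shows "complement_property (partition_lattice n) \<epsilon> (\<epsilon> / 28)"
  unfolding complement_property_def
proof (intro ballI impI)
  let ?P = "partition_lattice n"
  have pos: "0 < real n - 1" using n by simp
  have few: "real (card (nontrivial_blocks x)) \<le> \<epsilon> * (real n - 1) / 2 + 1"
    if "partition_on {1..n} x" "approx_modular ?P (\<epsilon> / 28) x" for x
    using few_nontrivial_blocks[OF that(1), of "\<epsilon> / 28 * (real n - 1)"] that(2)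
    unfolding approx_modular_partition_lattice_iff[OF n that(1)] by auto
  fix x assume "x \<in> carrier ?P" and am: "approx_modular ?P (\<epsilon> / 28) x"
  then have x: "partition_on {1..n} x" by (simp add: partition_lattice_simps)
  define c where "c = collapse n ({1..n} - \<Union>(nontrivial_blocks x))"
  have c: "partition_on {1..n} c" unfolding c_def by (rule partition_on_collapse)
  show "\<exists>x'\<in>carrier ?P. approx_modular ?P \<epsilon> x' \<and> lnorm ?P (ladd ?P x x') \<ge> 1 - \<epsilon> \<and>
        lnorm ?P x + lnorm ?P x' \<le> 1 + \<epsilon> \<and>
        (\<forall>y\<in>carrier ?P. approx_modular ?P (\<epsilon> / 28) y \<longrightarrow>
           lnorm ?P (ladd ?P x y) + lnorm ?P (ladd ?P x' y) \<le> 1 + lnorm ?P y + \<epsilon>)"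
  proof (intro bexI[of _ c] conjI ballI impI)
    show "c \<in> carrier ?P" using c by (simp add: partition_lattice_simps)
    show "approx_modular ?P \<epsilon> c"
      unfolding approx_modular_partition_lattice_iff[OF n c]
    proof (intro allI impI)
      fix w assume w: "partition_on {1..n} w"
      obtain z where z: "refines {1..n} z c" "refines {1..n} z w"
        "card (pjoin n c w) + card z \<le> card c + card w + 1"
        using collapse_meet[OF w, of "{1..n} - \<Union>(nontrivial_blocks x)"] unfolding c_def by blast
      show "\<exists>z. partition_on {1..n} z \<and>
        real (card (pjoin n c w)) + real (card z) \<le> real (card c) + real (card w) + \<epsilon> * (real n - 1) \<and>
        real (card c) \<le> real (card (pjoin n z c)) + \<epsilon> * (real n - 1) \<and>
        real (card w) \<le> real (card (pjoin n z w)) + \<epsilon> * (real n - 1)"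
        using z refines_imp_pjoin[OF z(1)] refines_imp_pjoin[OF z(2)] refines_partition_on[OF z(1)] \<epsilon>
        by (intro exI[of _ z]) auto
    qed
    have "real (card (pjoin n x c)) \<le> \<epsilon> * (real n - 1) / 2 + 2"
      using card_join_complement[OF x] few[OF x am] unfolding c_def by linarith
    then have "real (card (pjoin n x c)) - 1 \<le> \<epsilon> * (real n - 1)" using \<epsilon> by simp
    then show "lnorm ?P (ladd ?P x c) \<ge> 1 - \<epsilon>"
      unfolding partition_lattice_simps(2) lnorm_partition_lattice[OF partition_on_pjoin[OF x c]]
        pos_le_divide_eq[OF pos] by (simp add: algebra_simps)
    have "real n \<le> real (card x) + real (card c)"
      using card_complement_sum[OF x] unfolding c_def by simp
    then show "lnorm ?P x + lnorm ?P c \<le> 1 + \<epsilon>"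
      using \<epsilon> unfolding lnorm_partition_lattice[OF x] lnorm_partition_lattice[OF c]
        add_divide_distrib[symmetric] pos_divide_le_eq[OF pos] by (simp add: algebra_simps)
    fix y assume "y \<in> carrier ?P" and amy: "approx_modular ?P (\<epsilon> / 28) y"
    then have y: "partition_on {1..n} y" by (simp add: partition_lattice_simps)
    have "real (card y) \<le> real (card (pjoin n x y)) + real (card (pjoin n c y)) + \<epsilon> * (real n - 1) / 2 + 1"
      using card_le_joins_complement[OF x y] few[OF y amy] unfolding c_def by linarith
    then have "real (card y) + 1 \<le> real (card (pjoin n x y)) + real (card (pjoin n c y)) + \<epsilon> * (real n - 1)"
      using \<epsilon> by simp
    then have "lnorm ?P (ladd ?P x y) + lnorm ?P (ladd ?P c y) - lnorm ?P y \<le> 1 + \<epsilon>"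
      unfolding partition_lattice_simps(2) lnorm_partition_lattice[OF y]
        lnorm_partition_lattice[OF partition_on_pjoin[OF x y]]
        lnorm_partition_lattice[OF partition_on_pjoin[OF c y]]
        add_divide_distrib[symmetric] diff_divide_distrib[symmetric] pos_divide_le_eq[OF pos]
      by (simp add: algebra_simps)
    then show "lnorm ?P (ladd ?P x y) + lnorm ?P (ladd ?P c y) \<le> 1 + lnorm ?P y + \<epsilon>" by simp
  qed
qed

section \<open>Properties of models inherited from partition lattices\<close>

lemma transfer_eq:
  assumes M: "M \<Turnstile> T_FPL"
    and eq: "\<And>n e. (\<And>i. partition_on {1..n} (e i)) \<Longrightarrow>
      eval_tm (partition_lattice n) s e = eval_tm (partition_lattice n) t e"
    and e: "\<And>i. e i \<in> carrier M"
  shows "eval_tm M s e = eval_tm M t e"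
proof -
  have "eval M (Dist s t) e = 0"
  proof (rule theory_transfer[OF M bounded_structure_partition_lattice _ _ e])
    fix n :: nat and e' :: "nat \<Rightarrow> nat set set"
    assume n: "2 \<le> n" and e': "\<And>i. e' i \<in> carrier (partition_lattice n)"
    have "eval_tm (partition_lattice n) s e' = eval_tm (partition_lattice n) t e'"
      using e' by (intro eq) (simp add: partition_lattice_simps)
    then show "eval (partition_lattice n) (Dist s t) e' = 0"
      using ldist_partition_lattice_self
        eval_tm_closed[OF bounded_structure_partition_lattice[OF n] e'] by simp
  qed auto
  moreover have str: "is_lstruct M" using M by (simp add: models_def)
  ultimately show ?thesis
    using Metric_space.zero[of "carrier M" "ldist_on M" "eval_tm M s e" "eval_tm M t e"]
      eval_tm_closed[OF is_lstruct_bounded[OF str] e]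
    by (auto simp: is_lstruct_def ldist_on_def)
qed

lemma transfer_norm_inequality:
  fixes g :: "(nat \<Rightarrow> real) \<Rightarrow> real"
  assumes M: "M \<Turnstile> T_FPL" and g: "continuous_on UNIV g"
    and le: "\<And>n e. n \<ge> 2 \<Longrightarrow> (\<And>i. partition_on {1..n} (e i)) \<Longrightarrow>
      g (tuple (map (\<lambda>t. lnorm (partition_lattice n) (eval_tm (partition_lattice n) t e)) ts)) \<le> 0"
    and e: "\<And>i. e i \<in> carrier M"
  shows "g (tuple (map (\<lambda>t. lnorm M (eval_tm M t e)) ts)) \<le> 0"
proof -
  let ?\<phi> = "clip_conn g (map (\<lambda>t. Dist t Zero) ts)"
  have eval: "eval N ?\<phi> e = clip (g (tuple (map (\<lambda>t. lnorm N (eval_tm N t e)) ts)))"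
    for N :: "'b lstruct" and e
    by (simp add: eval_clip_conn lnorm_def comp_def)
  have "eval M ?\<phi> e = 0"
  proof (rule theory_transfer[OF M bounded_structure_partition_lattice _ _ e])
    show "is_formula ?\<phi>" by (rule is_formula_clip_conn[OF g]) auto
    fix n :: nat and e' :: "nat \<Rightarrow> nat set set" assume "2 \<le> n" "\<And>i. e' i \<in> carrier (partition_lattice n)"
    then show "eval (partition_lattice n) ?\<phi> e' = 0"
      unfolding eval clip_eq_0_iff by (intro le) (auto simp: partition_lattice_simps)
  qed auto
  then show ?thesis unfolding eval clip_eq_0_iff .
qed

context
  fixes M :: "'a lstruct"
  assumes M: "M \<Turnstile> T_FPL"
begin

lemma model_comm: "x \<in> carrier M \<Longrightarrow> y \<in> carrier M \<Longrightarrow> ladd M x y = ladd M y x"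
  using transfer_eq[OF M, of "Add (Var 0) (Var 1)" "Add (Var 1) (Var 0)" "(\<lambda>_. x)(1 := y)"]
  by (simp add: partition_lattice_simps pjoin_comm)

lemma model_assoc:
  "x \<in> carrier M \<Longrightarrow> y \<in> carrier M \<Longrightarrow> z \<in> carrier M \<Longrightarrow>
    ladd M (ladd M x y) z = ladd M x (ladd M y z)"
  using transfer_eq[OF M, of "Add (Add (Var 0) (Var 1)) (Var 2)" "Add (Var 0) (Add (Var 1) (Var 2))"
      "(\<lambda>_. x)(1 := y, 2 := z)"]
  by (simp add: partition_lattice_simps pjoin_assoc)

lemma model_idem: "x \<in> carrier M \<Longrightarrow> ladd M x x = x"
  using transfer_eq[OF M, of "Add (Var 0) (Var 0)" "Var 0" "\<lambda>_. x"]
  by (simp add: partition_lattice_simps pjoin_idem)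

lemma model_zero: "x \<in> carrier M \<Longrightarrow> ladd M x (lzero M) = x"
  using transfer_eq[OF M, of "Add (Var 0) Zero" "Var 0" "\<lambda>_. x"]
  by (simp add: partition_lattice_simps pjoin_bottom)

lemma model_one: "x \<in> carrier M \<Longrightarrow> ladd M x (lone M) = lone M"
  using transfer_eq[OF M, of "Add (Var 0) One" "One" "\<lambda>_. x"]
  by (simp add: partition_lattice_simps refines_imp_pjoin[OF refines_top])

lemma model_norm_one: "lnorm M (lone M) = 1"
proof -
  have "lzero M \<in> carrier M" using M by (simp add: models_def is_lstruct_def)
  then have "1 - lnorm M (lone M) \<le> 0"
    using transfer_norm_inequality[OF M, of "\<lambda>r. 1 - r 0" "[One]" "\<lambda>_. lzero M"]
    by (simp add: tuple_nth partition_lattice_simps(4) lnorm_partition_lattice[OF partition_on_top]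
        card_partition_top continuous_intros)
  moreover have "lnorm M (lone M) \<le> 1" using M by (auto simp: models_def is_lstruct_def lnorm_def)
  ultimately show ?thesis by simp
qed

lemma model_semimodular:
  assumes "x \<in> carrier M" "y \<in> carrier M" "z \<in> carrier M"
  shows "lnorm M (ladd M (ladd M z x) (ladd M z y)) + lnorm M z \<le> lnorm M (ladd M z x) + lnorm M (ladd M z y)"
proof -
  let ?zx = "Add (Var 2) (Var 0)" and ?zy = "Add (Var 2) (Var 1)"
  let ?ts = "[Add ?zx ?zy, Var 2, ?zx, ?zy]" and ?e = "(\<lambda>_. x)(1 := y, 2 := z)"
  have "(\<lambda>r. r 0 + r 1 - r 2 - r 3) (tuple (map (\<lambda>t. lnorm M (eval_tm M t ?e)) ?ts)) \<le> 0"
  proof (rule transfer_norm_inequality[OF M])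
    show "continuous_on UNIV (\<lambda>r::nat \<Rightarrow> real. r 0 + r 1 - r 2 - r 3)" by (intro continuous_intros) auto
    fix n :: nat and e :: "nat \<Rightarrow> nat set set" assume n: "2 \<le> n" and e: "\<And>i. partition_on {1..n} (e i)"
    have j: "partition_on {1..n} (pjoin n (e 2) (e 0))" "partition_on {1..n} (pjoin n (e 2) (e 1))"
      using e partition_on_pjoin by auto
    have "card (pjoin n (e 2) (e 0)) + card (pjoin n (e 2) (e 1))
      \<le> card (pjoin n (pjoin n (e 2) (e 0)) (pjoin n (e 2) (e 1))) + card (e 2)"
      by (rule card_semimodular[OF pjoin(1) pjoin(1)]) (rule e)+
    then have "lnorm (partition_lattice n) (pjoin n (pjoin n (e 2) (e 0)) (pjoin n (e 2) (e 1))) +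
        lnorm (partition_lattice n) (e 2) - lnorm (partition_lattice n) (pjoin n (e 2) (e 0)) -
        lnorm (partition_lattice n) (pjoin n (e 2) (e 1)) \<le> 0"
      using n unfolding lnorm_partition_lattice[OF j(1)] lnorm_partition_lattice[OF j(2)] lnorm_partition_lattice[OF e]
        lnorm_partition_lattice[OF partition_on_pjoin[OF j]]
        add_divide_distrib[symmetric] diff_divide_distrib[symmetric] by (intro divide_nonpos_pos) auto
    then show "(\<lambda>r. r 0 + r 1 - r 2 - r 3)
      (tuple (map (\<lambda>t. lnorm (partition_lattice n) (eval_tm (partition_lattice n) t e)) ?ts)) \<le> 0"
      by (simp add: tuple_nth partition_lattice_simps(2))
  qed (use assms in simp)
  then show ?thesis by (simp add: tuple_nth)
qed

lemma model_dist:
  assumes x: "x \<in> carrier M" and y: "y \<in> carrier M"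
  shows "ldist M x y = 2 * lnorm M (ladd M x y) - lnorm M x - lnorm M y"
proof -
  let ?\<phi> = "clip_conn (\<lambda>r. \<bar>r 0 - (2 * r 1 - r 2 - r 3)\<bar>) [Dist (Var 0) (Var 1), Dist (Add (Var 0) (Var 1)) Zero,
      Dist (Var 0) Zero, Dist (Var 1) Zero]"
  have "eval M ?\<phi> ((\<lambda>_. x)(1 := y)) = 0"
  proof (rule theory_transfer[OF M bounded_structure_partition_lattice])
    show "is_formula ?\<phi>" by (rule is_formula_clip_conn) (auto intro!: continuous_intros)
    fix n :: nat and e :: "nat \<Rightarrow> nat set set" assume n: "2 \<le> n" and "\<And>i. e i \<in> carrier (partition_lattice n)"
    then have e: "\<And>i. partition_on {1..n} (e i)" by (simp add: partition_lattice_simps)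
    have "ldist (partition_lattice n) (e 0) (e 1) =
      2 * lnorm (partition_lattice n) (pjoin n (e 0) (e 1)) - lnorm (partition_lattice n) (e 0)
        - lnorm (partition_lattice n) (e 1)"
      unfolding lnorm_partition_lattice[OF e] lnorm_partition_lattice[OF partition_on_pjoin[OF e e]]
        partition_lattice_simps(5) using n by (simp add: divide_simps)
    then show "eval (partition_lattice n) ?\<phi> e = 0"
      by (simp add: eval_clip_conn tuple_nth clip_eq_0_iff lnorm_def[symmetric] partition_lattice_simps(2))
  qed (use x y in auto)
  then show ?thesis by (simp add: eval_clip_conn tuple_nth clip_eq_0_iff lnorm_def)
qed

text \<open>The complement property is written as a formula, with implications \<open>p < \<delta> \<longrightarrow> q \<le> 0\<close> rendered as
  \<open>min (\<delta> - p) q \<le> 0\<close>.  As infima are not attained in \<open>M\<close>, the formula gives back the property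
  only with a margin \<open>\<eta>\<close>; this costs a factor of \<open>2\<close> in both parameters.\<close>
lemma model_complement_property:
  assumes inf: "infinite (carrier M)"
    and \<epsilon>: "0 < \<epsilon>" "\<epsilon> \<le> 1 / 2" and \<delta>: "0 < \<delta>" "\<delta> \<le> 1"
    and P: "\<And>n. n \<ge> N \<Longrightarrow> n \<ge> 2 \<Longrightarrow> complement_property (partition_lattice n) \<epsilon> \<delta>"
  shows "complement_property M (2 * \<epsilon>) (\<delta> / 2)"
proof -
  \<comment> \<open>The variables \<open>0\<close>, \<open>1\<close>, \<open>2\<close> stand for \<open>x\<close>, its complement \<open>x'\<close>, and \<open>y\<close>.\<close>
  define A where "A = clip_conn (\<lambda>r. min (\<delta> - r 0) (r 1 + r 2 - 1 - r 3 - \<epsilon>))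
    [modular_defect 2, Dist (Add (Var 0) (Var 2)) Zero, Dist (Add (Var 1) (Var 2)) Zero, Dist (Var 2) Zero]"
  define B where "B = clip_conn (\<lambda>r. max (max (r 0 - \<epsilon>) (1 - r 1 - \<epsilon>)) (max (r 2 + r 3 - 1 - \<epsilon>) (r 4)))
    [modular_defect 1, Dist (Add (Var 0) (Var 1)) Zero, Dist (Var 0) Zero, Dist (Var 1) Zero, SupQ 2 A]"
  define \<phi> where "\<phi> = clip_conn (\<lambda>r. min (\<delta> - r 0) (r 1)) [modular_defect 0, InfQ 1 B]"
  have A: "is_formula A"
    unfolding A_def by (rule is_formula_clip_conn) (auto intro!: continuous_intros is_formula_modular_defect)
  have B: "is_formula B"
    unfolding B_def using A by (intro is_formula_clip_conn) (auto intro!: continuous_intros is_formula_modular_defect)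
  have \<phi>: "is_formula \<phi>"
    unfolding \<phi>_def using B by (intro is_formula_clip_conn) (auto intro!: continuous_intros is_formula_modular_defect)
  have eval_A: "eval N A e = clip (min (\<delta> - eval N (modular_defect 2) e)
      (lnorm N (ladd N (e 0) (e 2)) + lnorm N (ladd N (e 1) (e 2)) - 1 - lnorm N (e 2) - \<epsilon>))"
    for N :: "'b lstruct" and e
    by (simp add: A_def eval_clip_conn tuple_nth lnorm_def)
  have eval_B: "eval N B e = clip (max (max (eval N (modular_defect 1) e - \<epsilon>)
      (1 - lnorm N (ladd N (e 0) (e 1)) - \<epsilon>))
      (max (lnorm N (e 0) + lnorm N (e 1) - 1 - \<epsilon>) (eval N (SupQ 2 A) e)))"
    for N :: "'b lstruct" and e
    by (simp add: B_def eval_clip_conn tuple_nth lnorm_def del: eval.simps(3))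
  have eval_\<phi>: "eval N \<phi> e = clip (min (\<delta> - eval N (modular_defect 0) e) (eval N (InfQ 1 B) e))"
    for N :: "'b lstruct" and e
    by (simp add: \<phi>_def eval_clip_conn tuple_nth del: eval.simps(3,4))
  have zero: "eval (partition_lattice n) \<phi> e = 0"
    if n: "n \<ge> N" "n \<ge> 2" and e: "\<And>i. e i \<in> carrier (partition_lattice n)" for n e
  proof (cases "eval (partition_lattice n) (modular_defect 0) e < \<delta>")
    case False
    then show ?thesis unfolding eval_\<phi> clip_eq_0_iff by linarith
  next
    case True
    let ?P = "partition_lattice n"
    note bP = bounded_structure_partition_lattice[OF n(2)]
    have "approx_modular ?P \<delta> (e 0)" using modular_defect_less_imp[OF bP, of e 0 \<delta>, OF e _ True \<delta>(2)] by simp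
    then obtain x' where x': "x' \<in> carrier ?P" "approx_modular ?P \<epsilon> x'"
      "lnorm ?P (ladd ?P (e 0) x') \<ge> 1 - \<epsilon>" "lnorm ?P (e 0) + lnorm ?P x' \<le> 1 + \<epsilon>"
      "\<And>y. y \<in> carrier ?P \<Longrightarrow> approx_modular ?P \<delta> y \<Longrightarrow>
         lnorm ?P (ladd ?P (e 0) y) + lnorm ?P (ladd ?P x' y) \<le> 1 + lnorm ?P y + \<epsilon>"
      using P[OF n] e unfolding complement_property_def by blast
    let ?e = "e(1 := x')"
    have e': "?e i \<in> carrier ?P" for i using e x'(1) by simp
    have "eval ?P (SupQ 2 A) ?e \<le> 0"
    proof (rule eval_SupQ_least[OF bP A e'])
      fix y assume y: "y \<in> carrier ?P"
      let ?f = "?e(2 := y)"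
      have f: "?f i \<in> carrier ?P" for i using e' y by simp
      show "eval ?P A ?f \<le> 0"
      proof (cases "eval ?P (modular_defect 2) ?f < \<delta>")
        case True
        then have "approx_modular ?P \<delta> y"
          using modular_defect_less_imp[OF bP, of ?f 2 \<delta>, OF f] \<delta>(2) by simp
        then show ?thesis unfolding eval_A using x'(5)[OF y] by (intro clip_le) auto
      next
        case False
        then show ?thesis unfolding eval_A by (intro clip_le) auto
      qed
    qed
    moreover have "eval ?P (modular_defect 1) ?e \<le> \<epsilon>"
      using \<epsilon> x'(2) by (intro approx_modular_imp_le[OF bP e']) auto
    ultimately have "eval ?P B ?e \<le> 0"
      unfolding eval_B using x'(3,4) by (intro clip_le) auto
    then have "eval ?P (InfQ 1 B) e \<le> 0"
      by (rule order_trans[OF eval_InfQ_lower[OF bP B, of e, OF e x'(1)]])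
    then show ?thesis unfolding eval_\<phi> clip_eq_0_iff by linarith
  qed
  have str: "is_lstruct M" using M by (simp add: models_def)
  note bM = is_lstruct_bounded[OF str]
  show ?thesis
    unfolding complement_property_def
  proof (intro ballI impI)
    fix x assume x: "x \<in> carrier M" and am: "approx_modular M (\<delta> / 2) x"
    let ?e = "\<lambda>_::nat. x"
    have e: "?e i \<in> carrier M" for i using x by simp
    have "eval M \<phi> ?e = 0"
      by (rule theory_transfer_large[OF M bounded_structure_partition_lattice ldist_partition_lattice_self inf \<phi> zero e])
    moreover have "eval M (modular_defect 0) ?e \<le> \<delta> / 2"
      using \<delta> am by (intro approx_modular_imp_le[OF bM e]) auto
    ultimately have "eval M (InfQ 1 B) ?e \<le> 0"
      using \<delta>(1) unfolding eval_\<phi> clip_eq_0_iff by (auto simp: min_le_iff_disj)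
    moreover define \<eta> where "\<eta> = min \<epsilon> (\<delta> / 2)"
    have \<eta>: "0 < \<eta>" "\<eta> \<le> 1" "\<eta> \<le> \<epsilon>" "\<eta> \<le> \<delta> / 2" using \<epsilon> \<delta> by (auto simp: \<eta>_def)
    ultimately have "eval M (InfQ 1 B) ?e < \<eta>" by linarith
    then obtain x' where x': "x' \<in> carrier M" "eval M B (?e(1 := x')) < \<eta>"
      by (rule eval_InfQ_lessE[OF bM B e])
    let ?f = "?e(1 := x')"
    have f: "?f i \<in> carrier M" for i using x x'(1) by simp
    have less: "eval M (modular_defect 1) ?f < \<epsilon> + \<eta>" "1 - lnorm M (ladd M x x') - \<epsilon> < \<eta>"
      "lnorm M x + lnorm M x' - 1 - \<epsilon> < \<eta>" "eval M (SupQ 2 A) ?f < \<eta>"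
      using clip_lessD[OF x'(2)[unfolded eval_B] \<eta>(2)] by auto
    show "\<exists>x'\<in>carrier M. approx_modular M (2 * \<epsilon>) x' \<and> lnorm M (ladd M x x') \<ge> 1 - 2 * \<epsilon> \<and>
        lnorm M x + lnorm M x' \<le> 1 + 2 * \<epsilon> \<and>
        (\<forall>y\<in>carrier M. approx_modular M (\<delta> / 2) y \<longrightarrow>
           lnorm M (ladd M x y) + lnorm M (ladd M x' y) \<le> 1 + lnorm M y + 2 * \<epsilon>)"
    proof (intro bexI[OF _ x'(1)] conjI ballI impI)
      show "approx_modular M (2 * \<epsilon>) x'"
        using modular_defect_less_imp[OF bM, of ?f 1 "2 * \<epsilon>", OF f] less(1) \<eta> \<epsilon> by simp
      show "lnorm M (ladd M x x') \<ge> 1 - 2 * \<epsilon>" "lnorm M x + lnorm M x' \<le> 1 + 2 * \<epsilon>"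
        using less(2,3) \<eta>(3) by auto
      fix y assume y: "y \<in> carrier M" and amy: "approx_modular M (\<delta> / 2) y"
      let ?g = "?f(2 := y)"
      have g: "?g i \<in> carrier M" for i using f y by simp
      have "eval M (modular_defect 2) ?g \<le> \<delta> / 2"
        using \<delta> amy by (intro approx_modular_imp_le[OF bM g]) auto
      moreover have "eval M A ?g < \<eta>"
        using eval_SupQ_upper[OF bM A, of ?f, OF f y, of 2] less(4) by linarith
      then have "min (\<delta> - eval M (modular_defect 2) ?g)
        (lnorm M (ladd M x y) + lnorm M (ladd M x' y) - 1 - lnorm M y - \<epsilon>) < \<eta>"
        using clip_lessD[OF _ \<eta>(2)] unfolding eval_A by simp
      ultimately show "lnorm M (ladd M x y) + lnorm M (ladd M x' y) \<le> 1 + lnorm M y + 2 * \<epsilon>"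
        using \<eta>(3,4) by (auto simp: min_less_iff_disj)
    qed
  qed
qed

lemma model_complements:
  assumes inf: "infinite (carrier M)" and \<epsilon>: "0 < \<epsilon>"
  shows "\<exists>\<delta>>0. complement_property M \<epsilon> \<delta>"
proof -
  define \<eta> where "\<eta> = min (\<epsilon> / 2) (1 / 2)"
  have \<eta>: "0 < \<eta>" "\<eta> \<le> 1 / 2" "2 * \<eta> \<le> \<epsilon>" using \<epsilon> by (auto simp: \<eta>_def)
  obtain N :: nat where N: "4 / \<eta> + 1 \<le> real N" using real_arch_simple by blast
  have "complement_property M (2 * \<eta>) (\<eta> / 28 / 2)"
  proof (rule model_complement_property[OF inf])
    fix n assume n: "N \<le> n" "2 \<le> n"
    have "4 / \<eta> \<le> real n - 1" using N n(1) by simp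
    then have "4 \<le> \<eta> * (real n - 1)" using \<eta>(1) by (simp add: field_simps)
    then show "complement_property (partition_lattice n) \<eta> (\<eta> / 28)"
      by (rule complement_property_partition_lattice[OF n(2)])
  qed (use \<eta> in auto)
  then have "complement_property M \<epsilon> (\<eta> / 28 / 2)" by (rule complement_property_mono[OF _ \<eta>(3)])
  then show ?thesis using \<eta>(1) by (intro exI[of _ "\<eta> / 28 / 2"]) auto
qed

end

section \<open>Lattice structure of a model\<close>

text \<open>A null sequence, kept folded so that its values stay atomic for linear arithmetic.\<close>
definition tol :: "nat \<Rightarrow> real" where
  "tol k = inverse (real (Suc k))"

lemma tol_pos: "0 < tol k"
  by (simp add: tol_def)

lemma tol_antimono: "k \<le> l \<Longrightarrow> tol l \<le> tol k"
  unfolding tol_def by (rule le_imp_inverse_le) auto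

lemma tol_small: "0 < \<epsilon> \<Longrightarrow> \<exists>k. tol k < \<epsilon>"
  unfolding tol_def by (rule reals_Archimedean)

text \<open>All that is needed of an infinite model of the theory.\<close>
locale complemented_semimodular_structure =
  fixes M :: "'a lstruct"
  assumes str: "is_lstruct M"
    and comm: "\<And>x y. x \<in> carrier M \<Longrightarrow> y \<in> carrier M \<Longrightarrow> ladd M x y = ladd M y x"
    and assoc: "\<And>x y z. x \<in> carrier M \<Longrightarrow> y \<in> carrier M \<Longrightarrow> z \<in> carrier M \<Longrightarrow>
      ladd M (ladd M x y) z = ladd M x (ladd M y z)"
    and idem: "\<And>x. x \<in> carrier M \<Longrightarrow> ladd M x x = x"
    and add_zero: "\<And>x. x \<in> carrier M \<Longrightarrow> ladd M x (lzero M) = x"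
    and add_one: "\<And>x. x \<in> carrier M \<Longrightarrow> ladd M x (lone M) = lone M"
    and norm_one: "lnorm M (lone M) = 1"
    and dist: "\<And>x y. x \<in> carrier M \<Longrightarrow> y \<in> carrier M \<Longrightarrow>
      ldist M x y = 2 * lnorm M (ladd M x y) - lnorm M x - lnorm M y"
    and semimodular: "\<And>x y z. x \<in> carrier M \<Longrightarrow> y \<in> carrier M \<Longrightarrow> z \<in> carrier M \<Longrightarrow>
      lnorm M (ladd M (ladd M z x) (ladd M z y)) + lnorm M z \<le> lnorm M (ladd M z x) + lnorm M (ladd M z y)"
    and complements: "\<And>\<epsilon>. 0 < \<epsilon> \<Longrightarrow> \<exists>\<delta>>0. complement_property M \<epsilon> \<delta>"
begin

abbreviation C where "C \<equiv> carrier M"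
abbreviation join (infixl \<open>\<boxplus>\<close> 65) where "x \<boxplus> y \<equiv> ladd M x y"
abbreviation meet (infixl \<open>\<boxdot>\<close> 70) where "x \<boxdot> y \<equiv> lmeet M x y"
abbreviation norm (\<open>\<nu>\<close>) where "\<nu> x \<equiv> lnorm M x"
abbreviation d where "d x y \<equiv> ldist M x y"

definition le (infix \<open>\<preceq>\<close> 50) where "x \<preceq> y \<longleftrightarrow> x \<boxplus> y = y"

lemma zero_in [simp]: "lzero M \<in> C" and one_in [simp]: "lone M \<in> C"
  and join_in [simp]: "x \<in> C \<Longrightarrow> y \<in> C \<Longrightarrow> x \<boxplus> y \<in> C"
  using str by (simp_all add: is_lstruct_def)

lemma d_sym: "x \<in> C \<Longrightarrow> y \<in> C \<Longrightarrow> d x y = d y x"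
  using dist comm by simp

lemma d_nonneg: "x \<in> C \<Longrightarrow> y \<in> C \<Longrightarrow> 0 \<le> d x y"
  using is_lstruct_bounded[OF str] by (simp add: bounded_structure_def)

lemma d_eq_0: "x \<in> C \<Longrightarrow> y \<in> C \<Longrightarrow> d x y = 0 \<Longrightarrow> x = y"
  using str Metric_space.zero[of C "ldist_on M" x y] by (auto simp: is_lstruct_def ldist_on_def)

lemma d_self: "x \<in> C \<Longrightarrow> d x x = 0"
  using dist[of x x] idem by simp

lemma d_triangle: "x \<in> C \<Longrightarrow> y \<in> C \<Longrightarrow> z \<in> C \<Longrightarrow> d x z \<le> d x y + d y z"
  using str Metric_space.triangle[of C "ldist_on M" x y z] by (auto simp: is_lstruct_def ldist_on_def)

lemma d_join_le:
  assumes "x \<in> C" "y \<in> C" "z \<in> C"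
  shows "d (z \<boxplus> x) (z \<boxplus> y) \<le> d x y"
proof -
  have "d (z \<boxplus> x) (z \<boxplus> y) \<le> d z z + d x y" using str assms by (simp add: is_lstruct_def)
  then show ?thesis using d_self[OF assms(3)] by simp
qed

lemma le_refl: "x \<in> C \<Longrightarrow> x \<preceq> x"
  using idem by (simp add: le_def)

lemma le_trans: "x \<in> C \<Longrightarrow> y \<in> C \<Longrightarrow> z \<in> C \<Longrightarrow> x \<preceq> y \<Longrightarrow> y \<preceq> z \<Longrightarrow> x \<preceq> z"
  unfolding le_def using assoc[of x y z] by simp

lemma le_antisym: "x \<in> C \<Longrightarrow> y \<in> C \<Longrightarrow> x \<preceq> y \<Longrightarrow> y \<preceq> x \<Longrightarrow> x = y"
  unfolding le_def using comm[of x y] by simp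

lemma le_join1: "x \<in> C \<Longrightarrow> y \<in> C \<Longrightarrow> x \<preceq> x \<boxplus> y"
  unfolding le_def using assoc[of x x y] idem by simp

lemma le_join2: "x \<in> C \<Longrightarrow> y \<in> C \<Longrightarrow> y \<preceq> x \<boxplus> y"
  using le_join1[of y x] comm by simp

lemma join_least: "x \<in> C \<Longrightarrow> y \<in> C \<Longrightarrow> z \<in> C \<Longrightarrow> x \<preceq> z \<Longrightarrow> y \<preceq> z \<Longrightarrow> x \<boxplus> y \<preceq> z"
  unfolding le_def using assoc[of x y z] by simp

lemma join_mono:
  assumes "x \<in> C" "x' \<in> C" "y \<in> C" "y' \<in> C" "x \<preceq> x'" "y \<preceq> y'"
  shows "x \<boxplus> y \<preceq> x' \<boxplus> y'"
proof (rule join_least)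
  show "x \<preceq> x' \<boxplus> y'" by (rule le_trans[OF _ _ _ assms(5) le_join1]) (use assms in auto)
  show "y \<preceq> x' \<boxplus> y'" by (rule le_trans[OF _ _ _ assms(6) le_join2]) (use assms in auto)
qed (use assms in auto)

lemma zero_le: "x \<in> C \<Longrightarrow> lzero M \<preceq> x"
  unfolding le_def using comm[of "lzero M" x] add_zero by simp

lemma le_one: "x \<in> C \<Longrightarrow> x \<preceq> lone M"
  unfolding le_def by (rule add_one)

lemma norm_zero: "\<nu> (lzero M) = 0"
  unfolding lnorm_def by (rule d_self) simp

lemma d_le: "x \<in> C \<Longrightarrow> y \<in> C \<Longrightarrow> x \<preceq> y \<Longrightarrow> d x y = \<nu> y - \<nu> x"
  using dist[of x y] by (simp add: le_def)

lemma norm_mono: "x \<in> C \<Longrightarrow> y \<in> C \<Longrightarrow> x \<preceq> y \<Longrightarrow> \<nu> x \<le> \<nu> y"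
  using d_le[of x y] d_nonneg[of x y] by simp

lemma le_norm_eq: "x \<in> C \<Longrightarrow> y \<in> C \<Longrightarrow> x \<preceq> y \<Longrightarrow> \<nu> y \<le> \<nu> x \<Longrightarrow> x = y"
  using d_le[of x y] d_nonneg[of x y] d_eq_0[of x y] by simp

lemma norm_nonneg: "x \<in> C \<Longrightarrow> 0 \<le> \<nu> x"
  using norm_mono[OF _ _ zero_le[of x]] norm_zero by simp

lemma norm_le_one: "x \<in> C \<Longrightarrow> \<nu> x \<le> 1"
  using norm_mono[OF _ _ le_one[of x]] norm_one by simp

lemma norm_diff_le_d:
  assumes "x \<in> C" "y \<in> C"
  shows "\<bar>\<nu> x - \<nu> y\<bar> \<le> d x y"
  using dist[OF assms] norm_mono[OF _ _ le_join1[OF assms]] norm_mono[OF _ _ le_join2[OF assms]] assms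
  by simp

lemma semimodular_lower_bound:
  assumes "x \<in> C" "y \<in> C" "z \<in> C" "z \<preceq> x" "z \<preceq> y"
  shows "\<nu> (x \<boxplus> y) + \<nu> z \<le> \<nu> x + \<nu> y"
  using semimodular[OF assms(1-3)] assms(4,5) by (simp add: le_def)

lemma norm_join_le: "x \<in> C \<Longrightarrow> y \<in> C \<Longrightarrow> \<nu> (x \<boxplus> y) \<le> \<nu> x + \<nu> y"
  using semimodular_lower_bound[of x y "lzero M"] zero_le norm_zero by simp

text \<open>The index produced for \<open>\<epsilon>\<close> is late enough to make the tolerance small as well, since the sequences below
  have properties that hold up to \<open>tol k\<close>.\<close>
lemma limit_exists:
  assumes z: "\<And>k. z k \<in> C"
    and cauchy: "\<And>\<epsilon>. 0 < \<epsilon> \<Longrightarrow> \<exists>K. \<forall>k\<ge>K. \<forall>l\<ge>K. d (z k) (z l) < \<epsilon>"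
  obtains w where "w \<in> C" "\<And>\<epsilon>. 0 < \<epsilon> \<Longrightarrow> \<exists>k. tol k < \<epsilon> \<and> d (z k) w < \<epsilon>"
proof -
  interpret Metric_space C "ldist_on M" using str by (simp add: is_lstruct_def)
  have d: "ldist_on M x y = d x y" if "x \<in> C" "y \<in> C" for x y using that by (simp add: ldist_on_def)
  have "MCauchy z"
    unfolding MCauchy_def using z cauchy by (auto simp: d)
  moreover have mcomplete using str by (simp add: is_lstruct_def)
  ultimately obtain w where w: "limitin mtopology z w sequentially" by (auto simp: mcomplete_def)
  then have wC: "w \<in> C" and lim: "\<And>\<epsilon>. 0 < \<epsilon> \<Longrightarrow> \<exists>K. \<forall>k\<ge>K. d (z k) w < \<epsilon>"
    by (auto simp: limit_metric_sequentially d) (metis d)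
  have "\<exists>k. tol k < \<epsilon> \<and> d (z k) w < \<epsilon>" if \<epsilon>: "0 < \<epsilon>" for \<epsilon> :: real
  proof -
    obtain K where K: "\<forall>k\<ge>K. d (z k) w < \<epsilon>" using lim[OF \<epsilon>] by blast
    obtain L where L: "tol L < \<epsilon>" using tol_small[OF \<epsilon>] by blast
    have "tol (K + L) \<le> tol L" by (rule tol_antimono) simp
    then have "tol (K + L) < \<epsilon>" using L by linarith
    moreover have "d (z (K + L)) w < \<epsilon>" using K by simp
    ultimately show ?thesis by blast
  qed
  then show ?thesis using that wC by blast
qed

text \<open>If \<open>z k\<close> and \<open>z l\<close> have almost maximal norm \<open>s\<close>, and so has their join, then they are close to each
  other because \<open>d u v = 2 * \<nu> (u \<boxplus> v) - \<nu> u - \<nu> v\<close>.  This constructs exact lower bounds from approximate ones,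
  both for the existence of meets and for metric modularity.\<close>
lemma lower_bound_limit:
  assumes xy: "x \<in> C" "y \<in> C" and z: "\<And>k. z k \<in> C"
    and norm: "\<And>k. s - tol k \<le> \<nu> (z k)"
    and norm2: "\<And>k l. \<nu> (z k \<boxplus> z l) \<le> s + 2 * tol k + 2 * tol l"
    and x: "\<And>k. d (z k \<boxplus> x) x \<le> tol k" and y: "\<And>k. d (z k \<boxplus> y) y \<le> tol k"
  shows "\<exists>w\<in>C. w \<preceq> x \<and> w \<preceq> y \<and> s \<le> \<nu> w"
proof -
  have dz: "d (z k) (z l) \<le> 5 * tol k + 5 * tol l" for k l
    using dist[OF z z, of k l] norm[of k] norm[of l] norm2[of k l] by simp
  obtain w where w: "w \<in> C" "\<And>\<epsilon>. 0 < \<epsilon> \<Longrightarrow> \<exists>k. tol k < \<epsilon> \<and> d (z k) w < \<epsilon>"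
  proof (rule limit_exists[OF z])
    fix \<epsilon> :: real assume "0 < \<epsilon>"
    then have "0 < \<epsilon> / 10" by simp
    then obtain K where K: "tol K < \<epsilon> / 10" using tol_small by blast
    have "d (z k) (z l) < \<epsilon>" if "K \<le> k" "K \<le> l" for k l
    proof -
      have "tol k \<le> tol K" "tol l \<le> tol K"
        using that by (auto intro: tol_antimono)
      then show ?thesis using dz[of k l] K by linarith
    qed
    then show "\<exists>K. \<forall>k\<ge>K. \<forall>l\<ge>K. d (z k) (z l) < \<epsilon>" by blast
  qed blast
  have below: "w \<preceq> t" if t: "t \<in> C" and dt: "\<And>k. d (z k \<boxplus> t) t \<le> tol k" for t
  proof -
    have "d (w \<boxplus> t) t \<le> 0 + \<epsilon>" if \<epsilon>: "0 < \<epsilon>" for \<epsilon>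
    proof -
      obtain k where k: "tol k < \<epsilon> / 2" "d (z k) w < \<epsilon> / 2" using w(2)[of "\<epsilon> / 2"] \<epsilon> by auto
      have "d (w \<boxplus> t) (z k \<boxplus> t) \<le> d w (z k)"
        using d_join_le[OF w(1) z[of k] t] comm[OF w(1) t] comm[OF z[of k] t] by simp
      then show ?thesis
        using d_triangle[of "w \<boxplus> t" "z k \<boxplus> t" t] dt[of k] k d_sym[OF w(1) z] w(1) z t by simp
    qed
    then have "d (w \<boxplus> t) t \<le> 0" by (rule field_le_epsilon)
    then show ?thesis using d_nonneg[of "w \<boxplus> t" t] d_eq_0[of "w \<boxplus> t" t] w(1) t by (simp add: le_def)
  qed
  have "s \<le> \<nu> w + \<epsilon>" if \<epsilon>: "0 < \<epsilon>" for \<epsilon>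
  proof -
    obtain k where k: "tol k < \<epsilon> / 2" "d (z k) w < \<epsilon> / 2" using w(2)[of "\<epsilon> / 2"] \<epsilon> by auto
    then show ?thesis using norm[of k] norm_diff_le_d[OF z w(1), of k] by linarith
  qed
  then have "s \<le> \<nu> w" by (rule field_le_epsilon)
  then show ?thesis using below[OF xy(1) x] below[OF xy(2) y] w(1) by blast
qed

text \<open>The lower bounds of \<open>x\<close> and \<open>y\<close> are closed under joins, so a sequence of them whose norms tend to the
  supremum converges, and a lower bound of maximal norm is the greatest one.\<close>
lemma meet_exists:
  assumes x: "x \<in> C" and y: "y \<in> C"
  shows "\<exists>m\<in>C. m \<preceq> x \<and> m \<preceq> y \<and> (\<forall>v\<in>C. v \<preceq> x \<longrightarrow> v \<preceq> y \<longrightarrow> v \<preceq> m)"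
proof -
  define S where "S = {z\<in>C. z \<preceq> x \<and> z \<preceq> y}"
  define s where "s = (SUP z\<in>S. \<nu> z)"
  have "lzero M \<in> S" using zero_le[OF x] zero_le[OF y] by (simp add: S_def)
  then have S0: "S \<noteq> {}" by blast
  have bdd: "bdd_above (\<nu> ` S)" by (rule bdd_aboveI[of _ 1]) (auto simp: S_def norm_le_one)
  have up: "\<nu> z \<le> s" if "z \<in> S" for z unfolding s_def by (rule cSUP_upper[OF that bdd])
  have joinS: "z \<boxplus> w \<in> S" if "z \<in> S" "w \<in> S" for z w
    using that join_least[of z w x] join_least[of z w y] x y by (simp add: S_def)
  have "\<exists>z\<in>S. s - tol k < \<nu> z" for k
    using less_cSUP_iff[OF S0 bdd, of "s - tol k"] tol_pos[of k] by (simp add: s_def)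
  then obtain z where z: "\<And>k. z k \<in> S" "\<And>k. s - tol k < \<nu> (z k)" by metis
  have "\<exists>w\<in>C. w \<preceq> x \<and> w \<preceq> y \<and> s \<le> \<nu> w"
  proof (rule lower_bound_limit[OF x y, of z])
    fix k l
    show "z k \<in> C" using z(1) by (simp add: S_def)
    show "s - tol k \<le> \<nu> (z k)" using z(2)[of k] by simp
    have "0 < tol k" "0 < tol l" by (rule tol_pos)+
    then show "\<nu> (z k \<boxplus> z l) \<le> s + 2 * tol k + 2 * tol l"
      using up[OF joinS[OF z(1) z(1), of k l]] by linarith
    have "z k \<boxplus> x = x" "z k \<boxplus> y = y" using z(1)[of k] by (auto simp: S_def le_def)
    then show "d (z k \<boxplus> x) x \<le> tol k" "d (z k \<boxplus> y) y \<le> tol k"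
      using d_self x y tol_pos[of k] by simp_all
  qed
  then obtain w where w: "w \<in> S" "s \<le> \<nu> w" by (auto simp: S_def)
  then have wC: "w \<in> C" by (simp add: S_def)
  have "v \<preceq> w" if v: "v \<in> C" "v \<preceq> x" "v \<preceq> y" for v
  proof -
    have "v \<in> S" using v by (simp add: S_def)
    then have "\<nu> (v \<boxplus> w) \<le> \<nu> w" using up[OF joinS[OF _ w(1)]] w(2) by fastforce
    then have "w = v \<boxplus> w" using le_norm_eq[OF wC _ le_join2[OF v(1) wC]] v(1) wC by simp
    then show ?thesis by (simp add: le_def)
  qed
  then show ?thesis using w(1) by (auto simp: S_def)
qed

lemma meet_is_greatest:
  assumes x: "x \<in> C" and y: "y \<in> C"
  shows "x \<boxdot> y \<in> C \<and> x \<boxdot> y \<preceq> x \<and> x \<boxdot> y \<preceq> y \<and> (\<forall>v\<in>C. v \<preceq> x \<longrightarrow> v \<preceq> y \<longrightarrow> v \<preceq> x \<boxdot> y)"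
proof -
  have "greatest (lorder M) m (Lower (lorder M) {x, y}) \<longleftrightarrow>
      m \<in> C \<and> m \<preceq> x \<and> m \<preceq> y \<and> (\<forall>v\<in>C. v \<preceq> x \<longrightarrow> v \<preceq> y \<longrightarrow> v \<preceq> m)" for m
    using x y unfolding greatest_def Lower_def lorder_def le_def by auto
  then show ?thesis
    unfolding lmeet_def Lattice.meet_def Lattice.inf_def using someI_ex meet_exists[OF x y]
    by (metis (mono_tags, lifting))
qed

lemma meet_in [simp]: "x \<in> C \<Longrightarrow> y \<in> C \<Longrightarrow> x \<boxdot> y \<in> C"
  and meet_le1: "x \<in> C \<Longrightarrow> y \<in> C \<Longrightarrow> x \<boxdot> y \<preceq> x"
  and meet_le2: "x \<in> C \<Longrightarrow> y \<in> C \<Longrightarrow> x \<boxdot> y \<preceq> y"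
  and meet_greatest: "x \<in> C \<Longrightarrow> y \<in> C \<Longrightarrow> v \<in> C \<Longrightarrow> v \<preceq> x \<Longrightarrow> v \<preceq> y \<Longrightarrow> v \<preceq> x \<boxdot> y"
  using meet_is_greatest by blast+

lemma meet_comm: "x \<boxdot> y = y \<boxdot> x"
  by (simp add: lmeet_def Lattice.meet_def insert_commute)

lemma meet_mono:
  assumes "x \<in> C" "x' \<in> C" "y \<in> C" "y' \<in> C" "x \<preceq> x'" "y \<preceq> y'"
  shows "x \<boxdot> y \<preceq> x' \<boxdot> y'"
proof (rule meet_greatest)
  show "x \<boxdot> y \<preceq> x'" by (rule le_trans[OF _ _ _ meet_le1 assms(5)]) (use assms in auto)
  show "x \<boxdot> y \<preceq> y'" by (rule le_trans[OF _ _ _ meet_le2 assms(6)]) (use assms in auto)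
qed (use assms in auto)

lemma meet_eq_of_le: "x \<in> C \<Longrightarrow> y \<in> C \<Longrightarrow> x \<preceq> y \<Longrightarrow> x \<boxdot> y = x"
  by (rule le_antisym) (auto intro: meet_le1 meet_greatest le_refl)

text \<open>An approximate lower bound \<open>u\<close> is an exact lower bound of \<open>u \<boxplus> x\<close> and \<open>u \<boxplus> y\<close>, which are
  close to \<open>x\<close> and \<open>y\<close>.  Semimodularity thus bounds the norm of the join of two approximate meets from above,
  as \<open>lower_bound_limit\<close> requires.\<close>
lemma metrically_modular_iff_approx:
  "metrically_modular M x \<longleftrightarrow> x \<in> C \<and> (\<forall>\<epsilon>>0. approx_modular M \<epsilon> x)"
proof
  assume mm: "metrically_modular M x"
  then have x: "x \<in> C" by (simp add: metrically_modular_def)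
  have "approx_modular M \<epsilon> x" if \<epsilon>: "0 < \<epsilon>" for \<epsilon>
    unfolding approx_modular_def
  proof
    fix y assume y: "y \<in> C"
    have "\<nu> (x \<boxplus> y) + \<nu> (x \<boxdot> y) = \<nu> x + \<nu> y" using mm y by (simp add: metrically_modular_def)
    then show "\<exists>z\<in>C. \<nu> x + \<nu> y - \<nu> (x \<boxplus> y) - \<nu> z \<le> \<epsilon> \<and> d (z \<boxplus> x) x \<le> \<epsilon> \<and> d (z \<boxplus> y) y \<le> \<epsilon>"
      using meet_le1[OF x y] meet_le2[OF x y] d_self x y \<epsilon>
      by (intro bexI[of _ "x \<boxdot> y"]) (auto simp: le_def)
  qed
  then show "x \<in> C \<and> (\<forall>\<epsilon>>0. approx_modular M \<epsilon> x)" using x by blast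
next
  assume am: "x \<in> C \<and> (\<forall>\<epsilon>>0. approx_modular M \<epsilon> x)"
  then have x: "x \<in> C" by simp
  have "\<nu> (x \<boxplus> y) + \<nu> (x \<boxdot> y) = \<nu> x + \<nu> y" if y: "y \<in> C" for y
  proof -
    let ?s = "\<nu> x + \<nu> y - \<nu> (x \<boxplus> y)"
    have "\<exists>z\<in>C. ?s - \<nu> z \<le> tol k \<and> d (z \<boxplus> x) x \<le> tol k \<and>
        d (z \<boxplus> y) y \<le> tol k" for k
      using am y tol_pos unfolding approx_modular_def by simp
    then obtain z where z: "\<And>k. z k \<in> C" "\<And>k. ?s - \<nu> (z k) \<le> tol k"
      "\<And>k. d (z k \<boxplus> x) x \<le> tol k" "\<And>k. d (z k \<boxplus> y) y \<le> tol k" by metis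
    have "\<exists>w\<in>C. w \<preceq> x \<and> w \<preceq> y \<and> ?s \<le> \<nu> w"
    proof (rule lower_bound_limit[OF x y z(1)])
      fix k l
      let ?u = "z k \<boxplus> z l"
      have u: "?u \<in> C" using z(1) by simp
      have near: "\<nu> (?u \<boxplus> t) \<le> \<nu> t + tol k + tol l"
        if t: "t \<in> C" and dt: "\<And>k. d (z k \<boxplus> t) t \<le> tol k" for t
      proof -
        have "?u \<boxplus> t = z k \<boxplus> (z l \<boxplus> t)" using assoc z(1) t by simp
        moreover have "d (z k \<boxplus> (z l \<boxplus> t)) (z k \<boxplus> t) \<le> d (z l \<boxplus> t) t"
          using z(1) t by (intro d_join_le) auto
        ultimately have "d (?u \<boxplus> t) (z k \<boxplus> t) \<le> tol l" using dt[of l] by simp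
        then have "\<nu> (?u \<boxplus> t) \<le> \<nu> (z k \<boxplus> t) + tol l"
          using norm_diff_le_d[of "?u \<boxplus> t" "z k \<boxplus> t"] u z(1) t by simp
        moreover have "\<nu> (z k \<boxplus> t) \<le> \<nu> t + tol k"
          using norm_diff_le_d[of "z k \<boxplus> t" t] dt[of k] z(1)[of k] t by simp
        ultimately show ?thesis by simp
      qed
      have "\<nu> (x \<boxplus> y) \<le> \<nu> ((?u \<boxplus> x) \<boxplus> (?u \<boxplus> y))"
        using u x y by (intro norm_mono join_mono le_join2) auto
      then show "\<nu> ?u \<le> ?s + 2 * tol k + 2 * tol l"
        using semimodular[OF x y u] near[OF x z(3)] near[OF y z(4)] by simp
      show "?s - tol k \<le> \<nu> (z k)" using z(2)[of k] by simp
    qed (rule z)+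
    then obtain w where w: "w \<in> C" "w \<preceq> x" "w \<preceq> y" "?s \<le> \<nu> w" by blast
    have "\<nu> w \<le> \<nu> (x \<boxdot> y)" using w x y by (intro norm_mono meet_greatest) auto
    then show ?thesis
      using w(4) semimodular_lower_bound[OF x y _ meet_le1[OF x y] meet_le2[OF x y]] x y by simp
  qed
  then show "metrically_modular M x" using x by (simp add: metrically_modular_def)
qed

lemma approx_modular_close:
  assumes x: "x \<in> C" and x': "x' \<in> C" and am: "approx_modular M \<epsilon> x" and t: "d x x' \<le> t"
  shows "approx_modular M (\<epsilon> + 2 * t) x'"
  unfolding approx_modular_def
proof
  fix y assume y: "y \<in> C"
  obtain z where z: "z \<in> C" "\<nu> x + \<nu> y - \<nu> (x \<boxplus> y) - \<nu> z \<le> \<epsilon>" "d (z \<boxplus> x) x \<le> \<epsilon>" "d (z \<boxplus> y) y \<le> \<epsilon>"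
    using am y unfolding approx_modular_def by blast
  have t0: "0 \<le> t" using d_nonneg[OF x x'] t by simp
  have "\<bar>\<nu> (x \<boxplus> y) - \<nu> (x' \<boxplus> y)\<bar> \<le> t"
    using norm_diff_le_d[of "x \<boxplus> y" "x' \<boxplus> y"] d_join_le[OF x x' y] comm x x' y t by simp
  moreover have "\<bar>\<nu> x - \<nu> x'\<bar> \<le> t" using norm_diff_le_d[OF x x'] t by simp
  moreover have "d (z \<boxplus> x') x' \<le> d (z \<boxplus> x') (z \<boxplus> x) + d (z \<boxplus> x) x + d x x'"
    using d_triangle[of "z \<boxplus> x'" "z \<boxplus> x" x'] d_triangle[of "z \<boxplus> x" x x'] x x' z(1) by simp
  moreover have "d (z \<boxplus> x') (z \<boxplus> x) \<le> t" using d_join_le[OF x' x z(1)] d_sym[OF x x'] t by simp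
  ultimately show "\<exists>z\<in>C. \<nu> x' + \<nu> y - \<nu> (x' \<boxplus> y) - \<nu> z \<le> \<epsilon> + 2 * t \<and>
      d (z \<boxplus> x') x' \<le> \<epsilon> + 2 * t \<and> d (z \<boxplus> y) y \<le> \<epsilon> + 2 * t"
    using z t t0 by (intro bexI[of _ z]) auto
qed

section \<open>Complements of metrically modular elements\<close>

lemma modularD: "x \<in> \<mu> M \<Longrightarrow> x \<in> C"
  by (simp add: metrically_modular_elements_def metrically_modular_def)

lemma modular_norm: "x \<in> \<mu> M \<Longrightarrow> y \<in> C \<Longrightarrow> \<nu> (x \<boxplus> y) + \<nu> (x \<boxdot> y) = \<nu> x + \<nu> y"
  by (simp add: metrically_modular_elements_def metrically_modular_def)

lemma modularI:
  assumes x: "x \<in> C" and ge: "\<And>y. y \<in> C \<Longrightarrow> \<nu> x + \<nu> y \<le> \<nu> (x \<boxplus> y) + \<nu> (x \<boxdot> y)"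
  shows "x \<in> \<mu> M"
proof -
  have "\<nu> (x \<boxplus> y) + \<nu> (x \<boxdot> y) = \<nu> x + \<nu> y" if y: "y \<in> C" for y
    using ge[OF y] semimodular_lower_bound[OF x y _ meet_le1[OF x y] meet_le2[OF x y]] x y by simp
  then show ?thesis using x by (simp add: metrically_modular_elements_def metrically_modular_def)
qed

lemma modular_approx: "x \<in> \<mu> M \<Longrightarrow> 0 < \<epsilon> \<Longrightarrow> approx_modular M \<epsilon> x"
  by (simp add: metrically_modular_elements_def metrically_modular_iff_approx)

text \<open>For smaller and smaller errors the complement property gives approximate complements \<open>c k\<close>.  If the
  error of \<open>c l\<close> is below the threshold \<open>\<delta> k\<close>, then \<open>c l\<close> may be taken for \<open>y\<close> in the
  property of \<open>c k\<close>.  As the join of \<open>x\<close> and \<open>c l\<close> has norm almost \<open>1\<close>, the join of \<open>c k\<close> and \<open>c l\<close> is hardly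
  larger than \<open>c l\<close>; and \<open>c k\<close> and \<open>c l\<close> have almost the same norm.  So the sequence is
  Cauchy.\<close>
lemma modular_complement_exists:
  assumes x: "x \<in> \<mu> M"
  shows "\<exists>c\<in>\<mu> M. x \<boxplus> c = lone M \<and> \<nu> x + \<nu> c \<le> 1 \<and>
    (\<forall>y\<in>\<mu> M. \<nu> (x \<boxplus> y) + \<nu> (c \<boxplus> y) \<le> 1 + \<nu> y)"
proof -
  note xC = modularD[OF x]
  have "\<forall>k. \<exists>\<delta>>0. complement_property M (tol k) \<delta>" using complements tol_pos by simp
  then obtain \<delta> where \<delta>: "\<And>k. 0 < \<delta> k" "\<And>k. complement_property M (tol k) (\<delta> k)" by metis
  have "\<exists>c\<in>C. approx_modular M (tol k) c \<and> \<nu> (x \<boxplus> c) \<ge> 1 - tol k \<and> \<nu> x + \<nu> c \<le> 1 + tol k \<and>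
      (\<forall>y\<in>C. approx_modular M (\<delta> k) y \<longrightarrow> \<nu> (x \<boxplus> y) + \<nu> (c \<boxplus> y) \<le> 1 + \<nu> y + tol k)" for k
    using \<delta>(2)[of k] xC modular_approx[OF x \<delta>(1)] unfolding complement_property_def by blast
  then obtain c where c: "\<And>k. c k \<in> C" "\<And>k. approx_modular M (tol k) (c k)"
    "\<And>k. \<nu> (x \<boxplus> c k) \<ge> 1 - tol k" "\<And>k. \<nu> x + \<nu> (c k) \<le> 1 + tol k"
    "\<And>k y. y \<in> C \<Longrightarrow> approx_modular M (\<delta> k) y \<Longrightarrow> \<nu> (x \<boxplus> y) + \<nu> (c k \<boxplus> y) \<le> 1 + \<nu> y + tol k"
    by metis
  have close: "d (c k) (c l) \<le> 3 * tol k + 3 * tol l" if "tol l \<le> \<delta> k" for k l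
  proof -
    have "\<nu> (x \<boxplus> c l) + \<nu> (c k \<boxplus> c l) \<le> 1 + \<nu> (c l) + tol k"
      by (rule c(5)[OF c(1) approx_modular_mono[OF c(2) that]])
    then show ?thesis
      using c(3)[of l] c(4)[of l] c(3)[of k] norm_join_le[OF xC c(1), of k] dist[OF c(1) c(1), of k l]
      by (simp add: algebra_simps)
  qed
  obtain w where w: "w \<in> C" "\<And>\<epsilon>. 0 < \<epsilon> \<Longrightarrow> \<exists>k. tol k < \<epsilon> \<and> d (c k) w < \<epsilon>"
  proof (rule limit_exists[OF c(1)])
    fix \<epsilon> :: real assume "0 < \<epsilon>"
    then have "0 < \<epsilon> / 12" by simp
    then obtain k where k: "tol k < \<epsilon> / 12" using tol_small by blast
    have "0 < min (\<delta> k) (\<epsilon> / 12)" using \<delta>(1) \<open>0 < \<epsilon>\<close> by simp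
    then obtain K where K: "tol K < min (\<delta> k) (\<epsilon> / 12)" using tol_small by blast
    have small: "tol l < min (\<delta> k) (\<epsilon> / 12)" if "K \<le> l" for l
    proof -
      have "tol l \<le> tol K" using that by (auto intro: tol_antimono)
      then show ?thesis using K by linarith
    qed
    have "d (c l) (c l') < \<epsilon>" if l: "K \<le> l" "K \<le> l'" for l l'
      using close[of l k] close[of l' k] small[OF l(1)] small[OF l(2)] k
        d_triangle[of "c l" "c k" "c l'"] d_sym[of "c l" "c k"] c(1) by simp
    then show "\<exists>K. \<forall>k\<ge>K. \<forall>l\<ge>K. d (c k) (c l) < \<epsilon>" by blast
  qed blast
  have near: "\<bar>\<nu> (c k \<boxplus> y) - \<nu> (w \<boxplus> y)\<bar> \<le> d (c k) w" if y: "y \<in> C" for k y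
    using norm_diff_le_d[of "c k \<boxplus> y" "w \<boxplus> y"] d_join_le[OF c(1) w(1) y, of k] comm c(1) w(1) y by simp
  have "approx_modular M \<epsilon> w" if \<epsilon>: "0 < \<epsilon>" for \<epsilon>
  proof -
    obtain k where k: "tol k < \<epsilon> / 3" "d (c k) w < \<epsilon> / 3" using w(2)[of "\<epsilon> / 3"] \<epsilon> by auto
    have "approx_modular M (tol k + 2 * (\<epsilon> / 3)) w"
      by (rule approx_modular_close[OF c(1) w(1) c(2)]) (use k in simp)
    then show ?thesis by (rule approx_modular_mono) (use k in simp)
  qed
  then have w\<mu>: "w \<in> \<mu> M" using w(1) by (simp add: metrically_modular_elements_def metrically_modular_iff_approx)
  have "1 \<le> \<nu> (x \<boxplus> w) + \<epsilon>" if \<epsilon>: "0 < \<epsilon>" for \<epsilon>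
  proof -
    obtain k where k: "tol k < \<epsilon> / 2" "d (c k) w < \<epsilon> / 2" using w(2)[of "\<epsilon> / 2"] \<epsilon> by auto
    then show ?thesis using c(3)[of k] near[OF xC, of k] comm[OF xC c(1), of k] comm[OF xC w(1)] by simp
  qed
  then have "1 \<le> \<nu> (x \<boxplus> w)" by (rule field_le_epsilon)
  then have one: "x \<boxplus> w = lone M"
    using le_norm_eq[OF _ one_in le_one] norm_one xC w(1) by simp
  have "\<nu> x + \<nu> w \<le> 1 + \<epsilon>" if \<epsilon>: "0 < \<epsilon>" for \<epsilon>
  proof -
    obtain k where k: "tol k < \<epsilon> / 2" "d (c k) w < \<epsilon> / 2" using w(2)[of "\<epsilon> / 2"] \<epsilon> by auto
    then show ?thesis using c(4)[of k] norm_diff_le_d[OF c(1) w(1), of k] by linarith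
  qed
  then have sum: "\<nu> x + \<nu> w \<le> 1" by (rule field_le_epsilon)
  have "\<nu> (x \<boxplus> y) + \<nu> (w \<boxplus> y) \<le> 1 + \<nu> y" if y: "y \<in> \<mu> M" for y
  proof (rule field_le_epsilon)
    fix \<epsilon> :: real assume \<epsilon>: "0 < \<epsilon>"
    obtain k where k: "tol k < \<epsilon> / 2" "d (c k) w < \<epsilon> / 2" using w(2)[of "\<epsilon> / 2"] \<epsilon> by auto
    show "\<nu> (x \<boxplus> y) + \<nu> (w \<boxplus> y) \<le> 1 + \<nu> y + \<epsilon>"
      using k c(5)[OF modularD[OF y] modular_approx[OF y \<delta>(1)], of k] near[OF modularD[OF y], of k] by linarith
  qed
  then show ?thesis using w\<mu> one sum by blast
qed

section \<open>The Boolean algebra of metrically modular elements\<close>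

lemma zero_modular: "lzero M \<in> \<mu> M"
proof (rule modularI)
  fix y assume "y \<in> C"
  then show "\<nu> (lzero M) + \<nu> y \<le> \<nu> (lzero M \<boxplus> y) + \<nu> (lzero M \<boxdot> y)"
    using zero_le[of y] norm_nonneg[of "lzero M \<boxdot> y"] norm_zero by (simp add: le_def)
qed simp

lemma one_modular: "lone M \<in> \<mu> M"
proof (rule modularI)
  fix y assume y: "y \<in> C"
  have "lone M \<boxdot> y = y" using meet_eq_of_le[OF y one_in le_one[OF y]] meet_comm by simp
  then show "\<nu> (lone M) + \<nu> y \<le> \<nu> (lone M \<boxplus> y) + \<nu> (lone M \<boxdot> y)"
    using norm_mono[OF _ _ le_join1[OF one_in y]] y by simp
qed simp

text \<open>A norm computation that is valid in every semimodular lattice: modularity of \<open>x\<close> is used for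
  \<open>y \<boxdot> z\<close> and for its join with the meet \<open>x \<boxdot> y\<close>, modularity of \<open>y\<close> for \<open>z\<close> and for the join of \<open>z\<close>
  with \<open>x \<boxdot> y\<close>.\<close>
lemma meet_modular:
  assumes x: "x \<in> \<mu> M" and y: "y \<in> \<mu> M"
  shows "x \<boxdot> y \<in> \<mu> M"
proof (rule modularI)
  note C = modularD[OF x] modularD[OF y]
  show w: "x \<boxdot> y \<in> C" using C by simp
  fix z assume z: "z \<in> C"
  let ?w = "x \<boxdot> y" and ?p = "y \<boxdot> z"
  have p: "?p \<in> C" using C z by simp
  have "x \<boxdot> ?p \<preceq> ?w \<boxdot> z"
    using C z p by (intro meet_greatest meet_mono le_refl meet_le1 le_trans[OF _ _ _ meet_le2 meet_le2]) auto
  then have 1: "\<nu> (x \<boxdot> ?p) \<le> \<nu> (?w \<boxdot> z)" using C z by (intro norm_mono) auto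
  have "y \<boxplus> (?w \<boxplus> z) = y \<boxplus> z"
    using assoc[OF C(2) w z] comm[OF C(2) w] meet_le2[OF C] by (simp add: le_def)
  then have 2: "\<nu> (y \<boxplus> z) + \<nu> (y \<boxdot> (?w \<boxplus> z)) = \<nu> y + \<nu> (?w \<boxplus> z)"
    using modular_norm[OF y, of "?w \<boxplus> z"] w z by simp
  have "?w \<boxplus> ?p \<preceq> y \<boxdot> (?w \<boxplus> z)"
    using C z w p by (intro meet_greatest join_least join_mono le_refl meet_le1 meet_le2) auto
  then have 3: "\<nu> (?w \<boxplus> ?p) \<le> \<nu> (y \<boxdot> (?w \<boxplus> z))" using C z by (intro norm_mono) auto
  have "x \<boxplus> (?w \<boxplus> ?p) = x \<boxplus> ?p"
    using assoc[OF C(1) w p] comm[OF C(1) w] meet_le1[OF C] by (simp add: le_def)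
  then have 4: "\<nu> (x \<boxplus> ?p) + \<nu> (x \<boxdot> (?w \<boxplus> ?p)) = \<nu> x + \<nu> (?w \<boxplus> ?p)"
    using modular_norm[OF x, of "?w \<boxplus> ?p"] w p by simp
  have "?w \<preceq> x \<boxdot> (?w \<boxplus> ?p)"
    using C w p by (intro meet_greatest meet_le1 le_join1) auto
  then have 5: "\<nu> ?w \<le> \<nu> (x \<boxdot> (?w \<boxplus> ?p))" using C w p by (intro norm_mono) auto
  show "\<nu> ?w + \<nu> z \<le> \<nu> (?w \<boxplus> z) + \<nu> (?w \<boxdot> z)"
    using 1 2 3 4 5 modular_norm[OF x p] modular_norm[OF y z] by linarith
qed

definition complement_of :: "'a \<Rightarrow> 'a \<Rightarrow> bool" where
  "complement_of x c \<longleftrightarrow> c \<in> \<mu> M \<and> x \<boxplus> c = lone M \<and> x \<boxdot> c = lzero M \<and> \<nu> x + \<nu> c = 1 \<and>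
    (\<forall>y\<in>\<mu> M. \<nu> y = \<nu> (x \<boxdot> y) + \<nu> (c \<boxdot> y))"

lemma le_zero: "x \<in> C \<Longrightarrow> x \<preceq> lzero M \<Longrightarrow> x = lzero M"
  by (rule le_antisym) (auto intro: zero_le)

lemma norm_join_disjoint:
  assumes "p \<in> \<mu> M" "q \<in> C" "p \<preceq> x" "q \<preceq> c" "x \<in> C" "c \<in> C" "x \<boxdot> c = lzero M"
  shows "\<nu> (p \<boxplus> q) = \<nu> p + \<nu> q"
proof -
  have p: "p \<in> C" by (rule modularD[OF assms(1)])
  have "p \<boxdot> q \<preceq> x \<boxdot> c" using assms p by (intro meet_mono) auto
  then have "p \<boxdot> q = lzero M" using assms p by (intro le_zero) auto
  then show ?thesis using modular_norm[OF assms(1,2)] norm_zero by simp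
qed

text \<open>The lower estimate of \<open>\<nu> (x \<boxdot> y) + \<nu> (c \<boxdot> y)\<close> is the inequality for the joins, rewritten by
  modularity; the upper one holds because the two meets are disjoint parts of \<open>y\<close>.\<close>
lemma complement_exists:
  assumes x: "x \<in> \<mu> M"
  obtains c where "complement_of x c"
proof -
  obtain c where c: "c \<in> \<mu> M" "x \<boxplus> c = lone M" "\<nu> x + \<nu> c \<le> 1"
    "\<And>y. y \<in> \<mu> M \<Longrightarrow> \<nu> (x \<boxplus> y) + \<nu> (c \<boxplus> y) \<le> 1 + \<nu> y"
    using modular_complement_exists[OF x] by blast
  note C = modularD[OF x] modularD[OF c(1)]
  have sum: "\<nu> x + \<nu> c = 1" using norm_join_le[OF C] c(2,3) norm_one by simp
  then have "\<nu> (x \<boxdot> c) = 0" using modular_norm[OF x C(2)] c(2) norm_one by simp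
  then have meet: "x \<boxdot> c = lzero M"
    using le_norm_eq[OF _ _ zero_le, of "x \<boxdot> c"] C norm_zero by simp
  have "\<nu> y = \<nu> (x \<boxdot> y) + \<nu> (c \<boxdot> y)" if y: "y \<in> \<mu> M" for y
  proof (rule antisym)
    note yC = modularD[OF y]
    show "\<nu> y \<le> \<nu> (x \<boxdot> y) + \<nu> (c \<boxdot> y)"
      using modular_norm[OF x yC] modular_norm[OF c(1) yC] c(4)[OF y] sum by linarith
    have "\<nu> ((x \<boxdot> y) \<boxplus> (c \<boxdot> y)) = \<nu> (x \<boxdot> y) + \<nu> (c \<boxdot> y)"
      using C yC by (intro norm_join_disjoint[OF meet_modular[OF x y] _ _ _ C meet] meet_le1) auto
    moreover have "\<nu> ((x \<boxdot> y) \<boxplus> (c \<boxdot> y)) \<le> \<nu> y"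
      using C yC by (intro norm_mono join_least meet_le2) auto
    ultimately show "\<nu> (x \<boxdot> y) + \<nu> (c \<boxdot> y) \<le> \<nu> y" by simp
  qed
  then have "complement_of x c" unfolding complement_of_def using c(1,2) sum meet by blast
  then show ?thesis by (rule that)
qed

lemma complement_decomposition:
  assumes x: "x \<in> \<mu> M" and c: "complement_of x c" and y: "y \<in> \<mu> M"
  shows "(x \<boxdot> y) \<boxplus> (c \<boxdot> y) = y"
proof -
  have c\<mu>: "c \<in> \<mu> M" using c by (simp add: complement_of_def)
  note C = modularD[OF x] modularD[OF c\<mu>] modularD[OF y]
  have "\<nu> ((x \<boxdot> y) \<boxplus> (c \<boxdot> y)) = \<nu> (x \<boxdot> y) + \<nu> (c \<boxdot> y)"
    using C c by (intro norm_join_disjoint[OF meet_modular[OF x y] _ _ _ C(1,2)] meet_le1)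
      (auto simp: complement_of_def)
  moreover have "\<nu> y = \<nu> (x \<boxdot> y) + \<nu> (c \<boxdot> y)" using c y by (simp add: complement_of_def)
  ultimately show ?thesis
    using C by (intro le_norm_eq join_least meet_le2) auto
qed

text \<open>The complement \<open>c\<close> of the meet of \<open>x'\<close> and \<open>y'\<close> lies above \<open>x\<close> and \<open>y\<close>, because these are
  disjoint from that meet, and it has the same norm as \<open>x \<boxplus> y\<close>.\<close>
lemma join_modular:
  assumes x: "x \<in> \<mu> M" and y: "y \<in> \<mu> M"
  shows "x \<boxplus> y \<in> \<mu> M"
proof -
  obtain x' where x': "complement_of x x'" by (rule complement_exists[OF x])
  obtain y' where y': "complement_of y y'" by (rule complement_exists[OF y])
  have \<mu>': "x' \<in> \<mu> M" "y' \<in> \<mu> M" using x' y' by (auto simp: complement_of_def)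
  let ?w = "x' \<boxdot> y'"
  have w: "?w \<in> \<mu> M" by (rule meet_modular[OF \<mu>'])
  obtain c where c: "complement_of ?w c" by (rule complement_exists[OF w])
  have c\<mu>: "c \<in> \<mu> M" using c by (simp add: complement_of_def)
  note C = modularD[OF x] modularD[OF y] modularD[OF \<mu>'(1)] modularD[OF \<mu>'(2)] modularD[OF w] modularD[OF c\<mu>]
  have below: "t \<preceq> c" if t: "t \<in> \<mu> M" "t' \<in> C" "?w \<preceq> t'" "t \<boxdot> t' = lzero M" for t t'
  proof -
    have tC: "t \<in> C" by (rule modularD[OF t(1)])
    have "?w \<boxdot> t \<preceq> t' \<boxdot> t" using C tC t by (intro meet_mono le_refl) auto
    then have "?w \<boxdot> t = lzero M" using C tC t meet_comm[of t t'] by (intro le_zero) auto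
    then have "lzero M \<boxplus> (c \<boxdot> t) = t" using complement_decomposition[OF w c t(1)] by simp
    then have "c \<boxdot> t = t" using zero_le[of "c \<boxdot> t"] C tC by (simp add: le_def)
    then show ?thesis using meet_le1[of c t] C tC by simp
  qed
  have "x \<boxplus> y \<preceq> c"
    using C x' y' by (intro join_least below[OF x C(3) meet_le1] below[OF y C(4) meet_le2])
      (auto simp: complement_of_def)
  moreover have "\<nu> c \<le> \<nu> (x \<boxplus> y)"
  proof -
    have "\<nu> x' = \<nu> (y \<boxdot> x') + \<nu> (y' \<boxdot> x')" using y' \<mu>'(1) unfolding complement_of_def by blast
    moreover have "\<nu> y = \<nu> (x \<boxdot> y) + \<nu> (x' \<boxdot> y)" using x' y unfolding complement_of_def by blast
    moreover have "\<nu> ?w + \<nu> c = 1" "\<nu> x + \<nu> x' = 1" using c x' unfolding complement_of_def by auto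
    ultimately show ?thesis
      using modular_norm[OF x C(2)] meet_comm[of x' y] meet_comm[of x' y'] by simp
  qed
  ultimately have "x \<boxplus> y = c" using C by (intro le_norm_eq) auto
  then show ?thesis using c\<mu> by simp
qed

text \<open>Split \<open>x \<boxdot> (y \<boxplus> z)\<close> into its parts below \<open>y\<close> and below the complement \<open>y'\<close>.  The part below \<open>y'\<close>
  lies below \<open>z\<close>, since \<open>y' \<boxdot> (y \<boxplus> z)\<close> and \<open>y' \<boxdot> z\<close> have the same norm.\<close>
lemma modular_distributive:
  assumes x: "x \<in> \<mu> M" and y: "y \<in> \<mu> M" and z: "z \<in> \<mu> M"
  shows "x \<boxdot> (y \<boxplus> z) = (x \<boxdot> y) \<boxplus> (x \<boxdot> z)"
proof -
  obtain y' where y': "complement_of y y'" by (rule complement_exists[OF y])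
  have y'\<mu>: "y' \<in> \<mu> M" using y' by (simp add: complement_of_def)
  note u = join_modular[OF y z]
  let ?u = "y \<boxplus> z" and ?w = "x \<boxdot> (y \<boxplus> z)"
  note w = meet_modular[OF x u]
  note C = modularD[OF x] modularD[OF y] modularD[OF z] modularD[OF y'\<mu>] modularD[OF u] modularD[OF w]
  have "y' \<boxdot> z = y' \<boxdot> ?u"
  proof (rule le_norm_eq)
    show "y' \<boxdot> z \<preceq> y' \<boxdot> ?u" using C by (intro meet_mono le_refl le_join2) auto
    have "y \<boxdot> ?u = y" using C by (intro meet_eq_of_le le_join1) auto
    moreover have "\<nu> ?u = \<nu> (y \<boxdot> ?u) + \<nu> (y' \<boxdot> ?u)" "\<nu> z = \<nu> (y \<boxdot> z) + \<nu> (y' \<boxdot> z)"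
      using y' u z unfolding complement_of_def by blast+
    ultimately show "\<nu> (y' \<boxdot> ?u) \<le> \<nu> (y' \<boxdot> z)" using modular_norm[OF y C(3)] by simp
  qed (use C in auto)
  then have "y' \<boxdot> ?u \<preceq> z" using meet_le2[OF C(4,3)] by simp
  moreover have "y' \<boxdot> ?w \<preceq> y' \<boxdot> ?u" using C by (intro meet_mono le_refl meet_le2) auto
  ultimately have q1: "y' \<boxdot> ?w \<preceq> z" using C by (intro le_trans[of "y' \<boxdot> ?w" "y' \<boxdot> ?u" z]) auto
  have xw: "t \<boxdot> ?w \<preceq> x" if "t \<in> C" for t
    using that C by (intro le_trans[of "t \<boxdot> ?w" ?w x] meet_le1 meet_le2) auto
  have "y' \<boxdot> ?w \<preceq> x \<boxdot> z" using C q1 xw by (intro meet_greatest) auto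
  moreover have "y \<boxdot> ?w \<preceq> x \<boxdot> y" using C xw by (intro meet_greatest meet_le1) auto
  ultimately have "(y \<boxdot> ?w) \<boxplus> (y' \<boxdot> ?w) \<preceq> (x \<boxdot> y) \<boxplus> (x \<boxdot> z)" using C by (intro join_mono) auto
  then have "?w \<preceq> (x \<boxdot> y) \<boxplus> (x \<boxdot> z)" using complement_decomposition[OF y y' w] by simp
  moreover have "(x \<boxdot> y) \<boxplus> (x \<boxdot> z) \<preceq> ?w"
    using C by (intro join_least meet_mono le_refl le_join1 le_join2) auto
  ultimately show ?thesis using C by (intro le_antisym) auto
qed

lemma boolean_sublattice_modular: "boolean_sublattice M (\<mu> M)"
  unfolding boolean_sublattice_def
proof (intro conjI ballI)
  show "\<mu> M \<subseteq> C" using modularD by blast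
  fix x assume "x \<in> \<mu> M"
  then obtain c where "complement_of x c" by (rule complement_exists)
  then show "\<exists>c\<in>\<mu> M. x \<boxplus> c = lone M \<and> x \<boxdot> c = lzero M" unfolding complement_of_def by blast
qed (auto intro: zero_modular one_modular join_modular meet_modular modular_distributive)

end

theorem proposition6p15:
  fixes M :: "'a lstruct"
  assumes "M \<Turnstile> T_FPL" and "infinite (carrier M)"
  shows "boolean_sublattice M (\<mu> M)"
proof -
  note M = assms(1)
  interpret complemented_semimodular_structure M
  proof
    show "is_lstruct M" using M by (simp add: models_def)
  qed (use model_comm[OF M] model_assoc[OF M] model_idem[OF M] model_zero[OF M] model_one[OF M]
      model_norm_one[OF M] model_dist[OF M] model_semimodular[OF M]
      model_complements[OF M assms(2)] in auto)
  show ?thesis by (rule boolean_sublattice_modular)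
qed

end
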